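(* Let $(r_i)_{i\geq 0}$ be the increasing sequence of all integers $r$ such that $r-2$ is a prime power or $0$ (where $1$ counts as a prime power), so that the sequence begins $2,3,4,5,6,7,9,10,11,13,15,\ldots$, and let $$q_i=\frac{r_i-3+\frac{2}{r_i-1}}{r_i^2-3r_i+3}.$$ Then for every $i\geq 0$ we have $$f_3(x)\leq\frac{r_i-1}{r_i^2-3r_i+3}\quad\text{for all }x\in(q_{i+1},q_i].$$ Furthermore, for $x\in[0,1]$, $$f_3(x)\geq\begin{cases}1&\text{if }x>\frac13;\\[2pt] \frac23&\text{if }\frac{8}{27}\leq x\leq\frac13;\\[2pt] 9x-2&\text{if }\frac{5}{18}\leq x\leq\frac{8}{27};\\[2pt] \frac{1}{r-1}&\text{if }\frac{1}{r+1}\leq x\leq\left(\frac{3r-4}{3r-3}\right)\frac1r\text{ for an integer }r\geq 3;\\[2pt] \frac{3rx-2}{r-2}&\text{if }\left(\frac{3r-4}{3r-3}\right)\frac1r\leq x\leq\frac1r\text{ for an integer }r\geq 4. \end{cases}$$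
   Context: A $k$-graph is a (finite, simple) hypergraph in which every edge consists of exactly $k$ vertices. For a $k$-graph $\mathcal{H}$, the codegree of a $(k-1)$-set $A$ of vertices is the number of vertices $v\notin A$ such that $A\cup\{v\}$ is an edge; the minimum codegree $\delta_{k-1}(\mathcal{H})$ is the minimum of this over all $(k-1)$-sets of vertices of $\mathcal{H}$ (so the minimum codegree of a $3$-graph is a minimum over all pairs of vertices). A tight walk in a $k$-graph is a finite sequence of edges in which consecutive edges share $k-1$ vertices. The tight components of $\mathcal{H}$ are the equivalence classes of edges under the relation that two edges are related if there is a tight walk in $\mathcal{H}$ from one to the other. A tight component meets (or covers) a vertex if some edge in the component contains that vertex. The function $f_k:[0,1]\to[0,1]$ is defined by letting $f_k(x)$ be the largest real number such that every $n$-vertex $k$-graph with minimum codegree at least $xn-O(1)$ has a tight component meeting at least $f_k(x)n$ of its vertices. This is understood asymptotically as $n\to\infty$: $f_k(x)$ is the supremum of all $c\in[0,1]$ such that for every constant $C\geq 0$ there is $n_0$ such that in every $k$-graph on $n\geq n_0$ vertices with minimum codegree at least $xn-C$, the maximum number of vertices met by a tight component (taken to be $0$ if there are no edges) is at least $cn$. *)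

theory Defs
  imports Complex_Main "HOL-Library.Infinite_Set" "HOL-Number_Theory.Prime_Powers"
begin

definition k_graph :: "nat \<Rightarrow> 'a set \<Rightarrow> 'a set set \<Rightarrow> bool" where
  "k_graph k V E \<longleftrightarrow> finite V \<and> (\<forall>e\<in>E. e \<subseteq> V \<and> card e = k)"

definition codegree :: "'a set \<Rightarrow> 'a set set \<Rightarrow> 'a set \<Rightarrow> nat" where
  "codegree V E A = card {v \<in> V - A. insert v A \<in> E}"

text \<open>The value is unspecified when \<open>card V < k - 1\<close>, so that there is no \<open>(k - 1)\<close>-set to
  minimise over. This does not affect \<open>tight_f\<close> below, which only concerns large vertex sets.\<close>

definition min_codegree :: "nat \<Rightarrow> 'a set \<Rightarrow> 'a set set \<Rightarrow> nat" where
  "min_codegree k V E = Min (codegree V E ` {A. A \<subseteq> V \<and> card A = k - 1})"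

definition tight_walk :: "nat \<Rightarrow> 'a set set \<Rightarrow> 'a set list \<Rightarrow> bool" where
  "tight_walk k E es \<longleftrightarrow>
     es \<noteq> [] \<and> set es \<subseteq> E \<and> successively (\<lambda>e e'. card (e \<inter> e') = k - 1) es"

text \<open>One-edge walks make the relation reflexive on \<open>E\<close>.\<close>

definition tight_rel :: "nat \<Rightarrow> 'a set set \<Rightarrow> ('a set \<times> 'a set) set" where
  "tight_rel k E = {(e, e'). \<exists>es. tight_walk k E es \<and> hd es = e \<and> last es = e'}"

definition tight_components :: "nat \<Rightarrow> 'a set set \<Rightarrow> 'a set set set" where
  "tight_components k E = E // tight_rel k E"

text \<open>The set of vertices met by a component \<open>C\<close> is \<open>\<Union>C\<close>; inserting \<open>0\<close> covers the case of no
  edges.\<close>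

definition max_tight_cover :: "nat \<Rightarrow> 'a set set \<Rightarrow> nat" where
  "max_tight_cover k E = Max (insert 0 ((\<lambda>C. card (\<Union>C)) ` tight_components k E))"

text \<open>Every finite \<open>k\<close>-graph is isomorphic to one whose vertices are natural numbers, so
  quantifying over vertex sets of type \<^typ>\<open>nat set\<close> loses no generality.\<close>

definition tight_f :: "nat \<Rightarrow> real \<Rightarrow> real" where
  "tight_f k x = Sup {c \<in> {0..1}. \<forall>C::real. C \<ge> 0 \<longrightarrow> (\<exists>n0. \<forall>n\<ge>n0. \<forall>(V :: nat set) E.
     k_graph k V E \<and> card V = n \<and> real (min_codegree k V E) \<ge> x * real n - C \<longrightarrow>
     real (max_tight_cover k E) \<ge> c * real n)}"

text \<open>\<^const>\<open>primepow\<close> excludes \<open>1\<close>, which counts as a prime power here.\<close>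

definition r_seq :: "nat \<Rightarrow> nat" where
  "r_seq = enumerate {m + 2 | m. m = 0 \<or> m = 1 \<or> primepow m}"

definition q_seq :: "nat \<Rightarrow> real" where
  "q_seq i = (let r = real (r_seq i) in (r - 3 + 2 / (r - 1)) / (r\<^sup>2 - 3 * r + 3))"

end

theory Submission
  imports "HOL-Algebra.Algebraic_Closure_Type" "Berlekamp_Zassenhaus.Finite_Field"
    "HOL-Number_Theory.Cong" Defs
begin

text \<open>
  In a 3-graph of positive minimum codegree, all edges through a given pair of vertices lie in one
  tight component. The tight components therefore colour the pairs of vertices, a pair lies in at
  least as many monochromatic triangles as its codegree, and a component meets every vertex that is
  incident with its colour. Conversely, the monochromatic triangles of an edge colouring of a
  complete graph form a 3-graph in which no tight walk leaves a colour. Both halves of the theorem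
  are thus about colourings of the complete graph on \<open>n\<close> vertices in which every pair lies in at
  least \<open>D\<close> monochromatic triangles (\<open>codegree_colouring\<close>): some colour must be incident with many
  vertices, and it need not be incident with too many.

  \<^emph>\<open>Lower bounds.\<close> If \<open>uv\<close> has colour \<open>c\<close>, then \<open>u\<close> and \<open>v\<close> have \<open>D\<close> common \<open>c\<close>-neighbours, so a
  vertex has more than \<open>D\<close> neighbours in each colour that it sees, and it sees few colours. A
  rainbow triangle yields three disjoint sets of \<open>D\<close> common neighbours; for \<open>x > 1/3\<close> there is none,
  and as each vertex sees at most two colours, one colour spans (\<open>spanning_colour\<close>). For smaller
  \<open>x\<close>, let \<open>r * D \<le> n \<le> (r + 1) * D\<close>, so that each vertex sees at most \<open>r\<close> colours
  (\<open>spread_lower_bound\<close>).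
  \<^item> If a vertex sees at most \<open>r - 2\<close> colours, then one of them reaches \<open>n / (r - 2)\<close> vertices.
  \<^item> If a vertex \<open>v\<close> sees \<open>r\<close> colours, then its colour neighbourhoods are little larger than \<open>D\<close> and
    hence almost monochromatic cliques. A colour \<open>j\<close> not seen at \<open>v\<close> has to cross these cliques, and
    this makes it large: it reaches at least \<open>(3 * r * D - 2 * n) / (r - 2)\<close> vertices
    (\<open>spread_large_of_rich_vertex\<close>). This is the origin of the slope in the statement. If there is
    no such \<open>j\<close> and the first case does not apply, then each vertex sees all but at most one of the
    same \<open>r\<close> colours, and one of these reaches \<open>(r - 1) * n / r\<close> vertices.
  \<^item> Otherwise every vertex sees at most \<open>k = r - 1\<close> colours. Any two vertices see a common colour, so
    the sets of colours seen form an intersecting family, weighted by the vertices. By Furedi's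
    theorem on fractional matchings (\<open>furedi_dichotomy\<close>) some colour reaches \<open>n / (k - 1)\<close> vertices
    or the family contains a projective plane of order \<open>k - 1\<close>. In the latter case it equals the
    plane (\<open>blocking_set_is_line\<close>), and averaging over the incident pairs of the plane bounds \<open>D\<close>
    (\<open>projective_plane_codegree_bound\<close>).

  Below \<open>1/3\<close>, this gives the lower bound on the ranges where it is not constant; the constant pieces
  follow because \<^const>\<open>tight_f\<close> is monotone.

  \<^emph>\<open>Upper bounds.\<close> For \<open>r = 2\<close> the bound is \<open>1\<close>. Otherwise, let \<open>q = r - 2\<close> be a prime power or \<open>1\<close>, and blow up the points of a projective
  plane of order \<open>q\<close> (a triangle for \<open>q = 1\<close>) to classes of equal size. A pair of vertices in
  different classes receives the line through their points, and inside each class the \<open>q + 1\<close> lines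
  through its point are distributed evenly. Each colour stays within the \<open>q + 1\<close> classes of its
  line, and the codegree is that of \<^const>\<open>q_seq\<close> up to an additive constant
  (\<open>blow_up_colouring\<close>). The plane is the usual one over a field with \<open>q\<close> elements, realised as the
  roots of \<open>X ^ q - X\<close> in an algebraically closed field.
\<close>

section \<open>Fractional matchings of intersecting families\<close>

text \<open>Eliminating one unknown reduces both the number of equations and the number of unknowns by one.\<close>

lemma homogeneous_system_nontrivial:
  fixes a :: "'s \<Rightarrow> 'e \<Rightarrow> real"
  assumes "finite S" "finite A" "card S < card A"
  shows "\<exists>l. (\<exists>e\<in>A. l e \<noteq> 0) \<and> (\<forall>s\<in>S. (\<Sum>e\<in>A. a s e * l e) = 0)"
  using assms
proof (induction S arbitrary: A a rule: finite_induct)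
  case empty
  then obtain e where "e \<in> A" by fastforce
  then show ?case by (intro exI[of _ "\<lambda>_. 1"]) auto
next
  case (insert s0 S)
  show ?case
  proof (cases "\<forall>e\<in>A. a s0 e = 0")
    case True
    have "card S < card A" using insert by simp
    with insert.IH[OF insert.prems(1)] obtain l
      where "\<exists>e\<in>A. l e \<noteq> 0" "\<forall>s\<in>S. (\<Sum>e\<in>A. a s e * l e) = 0" by meson
    with True show ?thesis by (intro exI[of _ l]) auto
  next
    case False
    then obtain e0 where e0: "e0 \<in> A" "a s0 e0 \<noteq> 0" by auto
    let ?A = "A - {e0}"
    let ?b = "\<lambda>s e. a s e - a s e0 * a s0 e / a s0 e0"
    have "finite ?A" "card S < card ?A" using insert e0 by auto
    from insert.IH[OF this, of ?b] obtain l where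
      l: "\<exists>e\<in>?A. l e \<noteq> 0" "\<forall>s\<in>S. (\<Sum>e\<in>?A. ?b s e * l e) = 0" by meson
    define m where "m e = (if e = e0 then - (\<Sum>e\<in>?A. a s0 e * l e) / a s0 e0 else l e)" for e
    have split: "(\<Sum>e\<in>A. a s e * m e) = a s e0 * m e0 + (\<Sum>e\<in>?A. a s e * l e)" for s
      using e0 insert.prems(1) by (subst sum.remove[of A e0]) (auto simp: m_def intro!: sum.cong)
    have "(\<Sum>e\<in>A. a s0 e * m e) = 0"
      unfolding split using e0 by (simp add: m_def)
    moreover have "(\<Sum>e\<in>A. a s e * m e) = 0" if "s \<in> S" for s
    proof -
      have "0 = (\<Sum>e\<in>?A. a s e * l e - a s e0 / a s0 e0 * (a s0 e * l e))"
        using bspec[OF l(2) that] by (simp add: algebra_simps)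
      also have "\<dots> = (\<Sum>e\<in>?A. a s e * l e) - a s e0 / a s0 e0 * (\<Sum>e\<in>?A. a s0 e * l e)"
        by (simp add: sum_subtractf sum_distrib_left)
      finally show ?thesis unfolding split by (simp add: m_def)
    qed
    moreover have "\<exists>e\<in>A. m e \<noteq> 0" using l(1) by (auto simp: m_def)
    ultimately show ?thesis by (intro exI[of _ m]) auto
  qed
qed

definition load :: "'c set set \<Rightarrow> ('c set \<Rightarrow> real) \<Rightarrow> 'c \<Rightarrow> real" where
  "load H w c = (\<Sum>E\<in>H. of_bool (c \<in> E) * w E)"

definition fractional_matching :: "'c set set \<Rightarrow> real \<Rightarrow> ('c set \<Rightarrow> real) \<Rightarrow> bool" where
  "fractional_matching H M w \<longleftrightarrow> (\<forall>E\<in>H. 0 \<le> w E) \<and> (\<forall>c. load H w c \<le> M)"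

lemma load_add: "load H (\<lambda>E. w E + t * l E) c = load H w c + t * load H l c"
  by (simp add: load_def sum.distrib sum_distrib_left algebra_simps)

lemma load_outside: "c \<notin> \<Union>H \<Longrightarrow> load H w c = 0"
  unfolding load_def by (rule sum.neutral) auto

text \<open>This plays the role of passing to a vertex of the polytope of fractional matchings. While the
  support has more members than there are saturated points, some nonzero change of the weights on
  the support leaves the load of all saturated points unchanged; choose its sign so that the total
  weight does not drop, and follow it until a weight vanishes or another point becomes saturated.\<close>

lemma exists_basic_fractional_matching:
  assumes "finite H" and fin: "\<And>E. E \<in> H \<Longrightarrow> finite E \<and> E \<noteq> {}"
    and "fractional_matching H M w"
  shows "\<exists>w'. fractional_matching H M w' \<and> sum w H \<le> sum w' H \<and>
    card {E \<in> H. w' E \<noteq> 0} \<le> card {c \<in> \<Union>H. load H w' c = M}"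
  using assms(3)
proof (induction "card {E \<in> H. w E \<noteq> 0} + card {c \<in> \<Union>H. load H w c \<noteq> M}"
    arbitrary: w rule: less_induct)
  case less
  have finU: "finite (\<Union>H)" using assms(1) fin by auto
  define A where "A = {E \<in> H. w E \<noteq> 0}"
  define S where "S = {c \<in> \<Union>H. load H w c = M}"
  have finA: "finite A" using assms(1) by (simp add: A_def)
  have finS: "finite S" using finU by (rule rev_finite_subset) (auto simp: S_def)
  have AH: "A \<subseteq> H" by (auto simp: A_def)
  show ?case
  proof (cases "card A \<le> card S")
    case True
    then show ?thesis using less.prems unfolding A_def S_def by blast
  next
    case False
    then have "card S < card A" by simp
    from homogeneous_system_nontrivial[OF finS finA this, of "\<lambda>c E. of_bool (c \<in> E)"]
    obtain l0 where l0: "\<exists>E\<in>A. l0 E \<noteq> 0"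
        "\<forall>c\<in>S. (\<Sum>E\<in>A. of_bool (c \<in> E) * l0 E) = (0::real)"
      by (elim exE conjE) (erule (1) that)
    define l1 where "l1 E = (if E \<in> A then l0 E else 0)" for E
    have load_l1: "load H l1 c = (\<Sum>E\<in>A. of_bool (c \<in> E) * l0 E)" for c
      unfolding load_def l1_def
      by (rule sum.mono_neutral_cong_right) (use assms(1) AH in auto)
    define l where "l E = (if sum l1 H \<ge> 0 then l1 E else - l1 E)" for E
    have l_load: "load H l c = (if sum l1 H \<ge> 0 then load H l1 c else - load H l1 c)" for c
      by (simp add: load_def l_def sum_negf)
    have l_sum: "sum l H \<ge> 0" by (cases "sum l1 H \<ge> 0") (simp_all add: l_def sum_negf)
    have l_S: "load H l c = 0" if "c \<in> S" for c
      using l0(2) that by (simp add: l_load load_l1)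
    have l_off: "l E = 0" if "E \<notin> A" for E using that by (simp add: l_def l1_def)
    obtain E1 where E1: "E1 \<in> A" "l E1 \<noteq> 0" using l0(1) by (auto simp: l_def l1_def)
    \<comment> \<open>The times at which a weight vanishes or a new point becomes saturated. If no weight decreases,
      then the load increases at every point of a member whose weight increases, so \<open>T\<close> is not
      empty.\<close>
    define T where "T = (\<lambda>E. w E / (- l E)) ` {E \<in> H. l E < 0} \<union>
      (\<lambda>c. (M - load H w c) / load H l c) ` {c \<in> \<Union>H. load H l c > 0}"
    have "finite {c \<in> \<Union>H. load H l c > 0}" using finU by (rule rev_finite_subset) auto
    then have finT: "finite T" using assms(1) by (simp add: T_def)
    have "T \<noteq> {}"
    proof (cases "\<exists>E\<in>H. l E < 0")
      case False
      then have nn: "l E \<ge> 0" if "E \<in> H" for E using that by force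
      obtain c where c: "c \<in> E1" using fin E1 AH by blast
      have "0 < l E1" using nn E1 AH by force
      also have "\<dots> = of_bool (c \<in> E1) * l E1" using c by simp
      also have "\<dots> \<le> load H l c" unfolding load_def
        by (rule member_le_sum) (use E1 AH nn assms(1) in auto)
      finally show ?thesis using c E1 AH by (auto simp: T_def)
    qed (auto simp: T_def)
    define t where "t = Min T"
    have wnn: "0 \<le> w E" if "E \<in> H" for E using less.prems that by (auto simp: fractional_matching_def)
    have wM: "load H w c \<le> M" for c using less.prems by (auto simp: fractional_matching_def)
    have "\<forall>s\<in>T. 0 \<le> s" using wnn wM by (auto simp: T_def divide_simps)
    then have t0: "0 \<le> t" using finT \<open>T \<noteq> {}\<close> by (simp add: t_def)
    have tT: "t \<in> T" using finT \<open>T \<noteq> {}\<close> by (simp add: t_def)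
    have tle: "t \<le> s" if "s \<in> T" for s using finT that by (simp add: t_def)
    define w' where "w' E = w E + t * l E" for E
    have load': "load H w' c = load H w c + t * load H l c" for c
      unfolding w'_def by (rule load_add)
    have fm: "fractional_matching H M w'" unfolding fractional_matching_def
    proof (intro conjI ballI allI)
      fix E assume E: "E \<in> H"
      show "0 \<le> w' E"
      proof (cases "l E < 0")
        case True
        then have "t \<le> w E / (- l E)" using E by (intro tle) (auto simp: T_def)
        then show ?thesis using True by (simp add: w'_def field_simps)
      qed (use wnn[OF E] t0 in \<open>simp add: w'_def\<close>)
    next
      fix c
      show "load H w' c \<le> M"
      proof (cases "c \<in> \<Union>H \<and> load H l c > 0")
        case True
        then have "t \<le> (M - load H w c) / load H l c" by (intro tle) (auto simp: T_def)
        then show ?thesis using True unfolding load' by (simp add: field_simps)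
      next
        case False
        then have "load H l c \<le> 0" using load_outside[of c H l] by force
        then show ?thesis using wM[of c] t0 unfolding load'
          by (meson add_mono_thms_linordered_semiring(1) add_decreasing2 mult_nonneg_nonpos)
      qed
    qed
    have sum': "sum w H \<le> sum w' H"
      using t0 l_sum by (simp add: w'_def sum.distrib flip: sum_distrib_left)
    let ?A' = "{E \<in> H. w' E \<noteq> 0}" and ?U = "{c \<in> \<Union>H. load H w c \<noteq> M}"
      and ?U' = "{c \<in> \<Union>H. load H w' c \<noteq> M}"
    have A'A: "?A' \<subseteq> A" using l_off by (auto simp: w'_def A_def)
    have U'U: "?U' \<subseteq> ?U"
    proof
      fix c assume c: "c \<in> ?U'"
      then have "c \<notin> S" using l_S[of c] by (auto simp: load' S_def)
      then show "c \<in> ?U" using c unfolding S_def by blast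
    qed
    have "?A' \<subset> A \<or> ?U' \<subset> ?U"
      using tT unfolding T_def
    proof
      assume "t \<in> (\<lambda>E. w E / (- l E)) ` {E \<in> H. l E < 0}"
      then obtain E where E: "E \<in> H" "l E < 0" "t = w E / (- l E)" by auto
      then have "w' E = 0" by (simp add: w'_def)
      moreover have "E \<in> A" using E l_off by force
      ultimately show ?thesis using A'A by blast
    next
      assume "t \<in> (\<lambda>c. (M - load H w c) / load H l c) ` {c \<in> \<Union>H. load H l c > 0}"
      then obtain c where c: "c \<in> \<Union>H" "load H l c > 0" "t = (M - load H w c) / load H l c" by auto
      then have "load H w' c = M" by (simp add: load')
      moreover have "c \<notin> S" using c l_S by force
      ultimately show ?thesis using U'U c(1) by (auto simp: S_def)
    qed
    moreover have "finite ?U" using finU by (rule rev_finite_subset) auto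
    ultimately have "card ?A' + card ?U' < card A + card ?U"
      using psubset_card_mono[OF finA] psubset_card_mono[of ?U ?U']
        card_mono[OF finA A'A] card_mono[of ?U ?U', OF _ U'U]
      by (elim disjE) (meson add_less_le_mono add_le_less_mono)+
    from less.hyps[OF this[unfolded A_def] fm] obtain w'' where
      "fractional_matching H M w''" "sum w' H \<le> sum w'' H"
      "card {E \<in> H. w'' E \<noteq> 0} \<le> card {c \<in> \<Union>H. load H w'' c = M}" by blast
    with sum' show ?thesis by (meson order_trans)
  qed
qed

text \<open>The parameter is the number of points on a line, so this is a plane of order \<open>k - 1\<close>. The counting
  conditions are those that come out of Furedi's argument; any two points also lie on a common line,
  by counting. For \<open>k = 2\<close> the plane is a triangle.\<close>

definition projective_plane :: "nat \<Rightarrow> 'c set set \<Rightarrow> bool" where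
  "projective_plane k G \<longleftrightarrow> finite G \<and> card G = k * (k - 1) + 1 \<and>
     (\<forall>E\<in>G. finite E \<and> card E = k) \<and> (\<forall>c\<in>\<Union>G. card {E \<in> G. c \<in> E} = k) \<and>
     (\<forall>E\<in>G. \<forall>F\<in>G. E \<noteq> F \<longrightarrow> card (E \<inter> F) = 1)"

lemma projective_planeD:
  assumes "projective_plane k G"
  shows "finite G" "card G = k * (k - 1) + 1"
    and "\<And>E. E \<in> G \<Longrightarrow> finite E" "\<And>E. E \<in> G \<Longrightarrow> card E = k"
    and "\<And>c. c \<in> \<Union>G \<Longrightarrow> card {E \<in> G. c \<in> E} = k"
    and "\<And>E F. \<lbrakk>E \<in> G; F \<in> G; E \<noteq> F\<rbrakk> \<Longrightarrow> card (E \<inter> F) = 1"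
  using assms unfolding projective_plane_def by auto

lemma sum_of_bool_eq_card:
  "finite A \<Longrightarrow> (\<Sum>x\<in>A. of_bool (P x)) = (of_nat (card {x \<in> A. P x}) :: 'b::semiring_1)"
  by (simp add: of_bool_def sum.If_cases Int_def)

lemma sum_incidences:
  assumes "finite G" "finite S"
  shows "(\<Sum>c\<in>S. card {E \<in> G. c \<in> E}) = (\<Sum>E\<in>G. card (E \<inter> S))"
proof -
  have "(\<Sum>c\<in>S. card {E \<in> G. c \<in> E}) = (\<Sum>c\<in>S. \<Sum>E\<in>G. of_bool (c \<in> E))"
    using assms by (simp only: sum_of_bool_eq_card of_nat_id)
  also have "\<dots> = (\<Sum>E\<in>G. \<Sum>c\<in>S. of_bool (c \<in> E))" by (rule sum.swap)
  also have "\<dots> = (\<Sum>E\<in>G. card (E \<inter> S))"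
    using assms by (simp only: sum_of_bool_eq_card of_nat_id Int_def conj_commute)
  finally show ?thesis .
qed

text \<open>The theorem of Furedi on fractional matchings of intersecting families. Adding the loads of the points
  of a member \<open>E\<close> counts every member at least once and \<open>E\<close> itself \<open>card E\<close> times, so the total weight
  is at most \<open>card E * M - (card E - 1) * u E\<close>. Hence, if the total exceeds \<open>(k - 1) * M\<close>, all members
  have \<open>k\<close> elements and weight less than \<open>M / (k - 1)\<close>, so that a saturated point lies in at least \<open>k\<close>
  members of the support. For a basic matching the support has no more members than there are
  saturated points, and double counting incidences turns all these inequalities into equations,
  which say that the support is a projective plane.\<close>

theorem furedi_dichotomy:
  assumes finH: "finite H" and fin: "\<And>E. E \<in> H \<Longrightarrow> finite E \<and> card E \<le> k"
    and int: "\<And>E F. E \<in> H \<Longrightarrow> F \<in> H \<Longrightarrow> E \<inter> F \<noteq> {}"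
    and k: "k \<ge> 2" and M: "M > 0" and w: "fractional_matching H M w"
  shows "sum w H \<le> real (k - 1) * M \<or> (\<exists>G\<subseteq>H. projective_plane k G)"
proof -
  have ne: "E \<noteq> {}" if "E \<in> H" for E using int that by blast
  obtain u where u: "fractional_matching H M u" "sum w H \<le> sum u H"
      "card {E \<in> H. u E \<noteq> 0} \<le> card {c \<in> \<Union>H. load H u c = M}"
    using exists_basic_fractional_matching[OF finH _ w] fin ne by blast
  have unn: "0 \<le> u E" if "E \<in> H" for E using u(1) that by (auto simp: fractional_matching_def)
  have uM: "load H u c \<le> M" for c using u(1) by (auto simp: fractional_matching_def)
  have swap: "(\<Sum>c\<in>E. load H u c) = (\<Sum>F\<in>H. real (card (E \<inter> F)) * u F)" if "finite E" for E
  proof -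
    have "(\<Sum>c\<in>E. load H u c) = (\<Sum>F\<in>H. \<Sum>c\<in>E. of_bool (c \<in> F) * u F)"
      unfolding load_def by (rule sum.swap)
    also have "\<dots> = (\<Sum>F\<in>H. real (card (E \<inter> F)) * u F)"
      using that by (simp add: sum_of_bool_eq_card Int_def flip: sum_distrib_right)
    finally show ?thesis .
  qed
  have key: "sum u H + (real (card E) - 1) * u E \<le> real (card E) * M" if E: "E \<in> H" for E
  proof -
    have "sum u H + (real (card E) - 1) * u E = real (card E) * u E + sum u (H - {E})"
      using finH E by (simp add: sum.remove algebra_simps)
    also have "\<dots> \<le> real (card (E \<inter> E)) * u E + (\<Sum>F\<in>H - {E}. real (card (E \<inter> F)) * u F)"
    proof -
      have "1 * u F \<le> real (card (E \<inter> F)) * u F" if "F \<in> H" for F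
      proof (rule mult_right_mono[OF _ unn[OF that]])
        have "card (E \<inter> F) \<noteq> 0" using int[OF E that] fin[OF E] by simp
        then show "1 \<le> real (card (E \<inter> F))" by simp
      qed
      then show ?thesis by (auto intro!: sum_mono)
    qed
    also have "\<dots> = (\<Sum>F\<in>H. real (card (E \<inter> F)) * u F)"
      using finH E by (simp add: sum.remove)
    also have "\<dots> = (\<Sum>c\<in>E. load H u c)" using swap fin[OF E] by simp
    also have "\<dots> \<le> (\<Sum>c\<in>E. M)" by (rule sum_mono) (rule uM)
    finally show ?thesis by simp
  qed
  show ?thesis
  proof (cases "sum u H \<le> real (k - 1) * M")
    case True
    with u(2) show ?thesis by linarith
  next
    case False
    define G where "G = {E \<in> H. u E \<noteq> 0}"
    define S where "S = {c \<in> \<Union>H. load H u c = M}"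
    have GH: "G \<subseteq> H" and finG: "finite G" using finH by (auto simp: G_def)
    have finS: "finite S" unfolding S_def using finH fin by auto
    have GS: "card G \<le> card S" using u(3) by (simp add: G_def S_def)
    have cardG: "card E = k" if "E \<in> H" for E
    proof (rule ccontr)
      assume "card E \<noteq> k"
      then have c: "card E \<le> k - 1" "1 \<le> card E"
        using fin[OF that] ne[OF that] by (auto simp: card_gt_0_iff Suc_le_eq)
      have "sum u H \<le> real (card E) * M"
        using key[OF that] unn[OF that] c(2)
        by (smt (verit) mult_nonneg_nonneg of_nat_1 of_nat_mono)
      also have "\<dots> \<le> real (k - 1) * M" using c M by (intro mult_right_mono) auto
      finally show False using False by simp
    qed
    have small: "real (k - 1) * u E < M" if "E \<in> H" for E
      using key[OF that] False k cardG[OF that] by (simp add: of_nat_diff algebra_simps)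
    have suppsum: "(\<Sum>E\<in>H. f E * u E) = (\<Sum>E\<in>G. f E * u E)" for f
      by (rule sum.mono_neutral_right) (use finH in \<open>auto simp: G_def\<close>)
    have deg: "k \<le> card {E \<in> G. c \<in> E}" if "c \<in> S" for c
    proof -
      have "M = (\<Sum>E\<in>G. of_bool (c \<in> E) * u E)"
        using that suppsum[of "\<lambda>E. of_bool (c \<in> E)"] by (simp add: S_def load_def)
      also have "\<dots> = (\<Sum>E\<in>{E \<in> G. c \<in> E}. u E)"
        by (simp add: of_bool_def if_distrib[of "\<lambda>x. x * _"] sum.inter_filter finG cong: if_cong)
      finally have Meq: "M = (\<Sum>E\<in>{E \<in> G. c \<in> E}. u E)" .
      then have ne: "{E \<in> G. c \<in> E} \<noteq> {}" using M by (metis less_irrefl sum.empty)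
      have "real (k - 1) * M = (\<Sum>E\<in>{E \<in> G. c \<in> E}. real (k - 1) * u E)"
        by (subst Meq) (simp add: sum_distrib_left)
      also have "\<dots> < (\<Sum>E\<in>{E \<in> G. c \<in> E}. M)"
        using finG ne GH by (intro sum_strict_mono small) auto
      finally have "real (k - 1) < real (card {E \<in> G. c \<in> E})" using M by simp
      then show ?thesis by simp
    qed
    have inc: "(\<Sum>c\<in>S. card {E \<in> G. c \<in> E}) = (\<Sum>E\<in>G. card (E \<inter> S))"
      by (rule sum_incidences[OF finG finS])
    have cle: "card (E \<inter> S) \<le> k" if "E \<in> G" for E
      using card_mono[of E "E \<inter> S"] fin cardG that GH by auto
    have lo: "k * card S \<le> (\<Sum>c\<in>S. card {E \<in> G. c \<in> E})"
      using sum_mono[of S "\<lambda>_. k", OF deg] by (simp add: mult.commute)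
    have hi: "(\<Sum>E\<in>G. card (E \<inter> S)) \<le> k * card G"
      using sum_mono[of G _ "\<lambda>_. k", OF cle] by (simp add: mult.commute)
    have "k * card S \<le> k * card G" using lo hi inc by linarith
    then have GS: "card G = card S" using GS k by simp
    have degS: "card {E \<in> G. c \<in> E} = k" if "c \<in> S" for c
    proof (rule ccontr)
      assume "card {E \<in> G. c \<in> E} \<noteq> k"
      then have "k < card {E \<in> G. c \<in> E}" using deg[OF that] by simp
      then have "(\<Sum>c\<in>S. k) < (\<Sum>c\<in>S. card {E \<in> G. c \<in> E})"
        using deg that finS by (intro sum_strict_mono_ex1) (auto simp: le_neq_implies_less)
      then show False using hi inc GS by (simp add: mult.commute)
    qed
    have ES: "E \<subseteq> S" if "E \<in> G" for E
    proof (rule ccontr)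
      assume "\<not> E \<subseteq> S"
      then have "card (E \<inter> S) < card E"
        using fin that GH by (intro psubset_card_mono) auto
      then have "card (E \<inter> S) < k" using cardG that GH by auto
      then have "(\<Sum>E\<in>G. card (E \<inter> S)) < (\<Sum>E\<in>G. k)"
        using cle that finG by (intro sum_strict_mono_ex1) auto
      then show False using lo inc GS by (simp add: mult.commute)
    qed
    have tot: "real k * sum u H = real (card S) * M"
    proof -
      have "real k * sum u H = (\<Sum>E\<in>H. real k * u E)" by (simp add: sum_distrib_left)
      also have "\<dots> = (\<Sum>E\<in>G. real k * u E)" by (rule suppsum)
      also have "\<dots> = (\<Sum>E\<in>G. real (card (S \<inter> E)) * u E)"
        using ES cardG GH by (intro sum.cong) (auto simp: Int_absorb1)
      also have "\<dots> = (\<Sum>c\<in>S. load H u c)"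
        by (simp only: swap[OF finS] suppsum[of "\<lambda>E. real (card (S \<inter> E))"])
      also have "\<dots> = real (card S) * M" by (simp add: S_def)
      finally show ?thesis .
    qed
    have "real k * (real (k - 1) * M) < real (card S) * M"
      unfolding tot[symmetric] using False k by (intro mult_strict_left_mono) auto
    then have "real (k * (k - 1)) < real (card S)" using M by simp
    then have big: "k * (k - 1) < card G" using GS by linarith
    have inter: "(\<Sum>F\<in>G. card (E \<inter> F)) = k * k" if "E \<in> G" for E
    proof -
      have "(\<Sum>F\<in>G. card (E \<inter> F)) = (\<Sum>c\<in>E. card {F \<in> G. c \<in> F})"
        using sum_incidences[OF finG, of E] fin that GH by (simp add: Int_commute subset_iff)
      also have "\<dots> = (\<Sum>c\<in>E. k)" using ES[OF that] degS by (intro sum.cong) auto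
      finally show ?thesis using cardG that GH by auto
    qed
    have rest: "(\<Sum>F\<in>G - {E}. card (E \<inter> F)) = k * (k - 1)" if "E \<in> G" for E
    proof -
      have "(\<Sum>F\<in>G. card (E \<inter> F)) = card (E \<inter> E) + (\<Sum>F\<in>G - {E}. card (E \<inter> F))"
        using finG that by (rule sum.remove)
      then show ?thesis using inter[OF that] cardG that GH by (auto simp: diff_mult_distrib2)
    qed
    have one: "1 \<le> card (E \<inter> F)" if "E \<in> G" "F \<in> G" for E F
      using int[of E F] fin[of E] that GH by (auto simp: Suc_le_eq card_gt_0_iff)
    have "card G \<noteq> 0" using big by simp
    then obtain E0 where E0: "E0 \<in> G" by fastforce
    have "card (G - {E0}) \<le> (\<Sum>F\<in>G - {E0}. card (E0 \<inter> F))"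
      using sum_mono[of "G - {E0}" "\<lambda>_. 1" "\<lambda>F. card (E0 \<inter> F)"] one[OF E0] by simp
    then have eqG: "card G = k * (k - 1) + 1"
      using rest[OF E0] big E0 finG by simp
    have "card (E \<inter> F) = 1" if EF: "E \<in> G" "F \<in> G" "E \<noteq> F" for E F
    proof (rule ccontr)
      assume "card (E \<inter> F) \<noteq> 1"
      then have "1 < card (E \<inter> F)" using one[OF EF(1,2)] by simp
      then have "(\<Sum>F\<in>G - {E}. 1) < (\<Sum>F\<in>G - {E}. card (E \<inter> F))"
        using one[OF EF(1)] EF finG
        by (intro sum_strict_mono_ex1) (auto simp: le_neq_implies_less)
      then show False using rest[OF EF(1)] eqG EF finG by simp
    qed
    then have "projective_plane k G" unfolding projective_plane_def
      using finG eqG degS ES fin cardG GH by (auto simp: subset_iff)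
    with GH show ?thesis by blast
  qed
qed

text \<open>Count incidences in two ways.\<close>

lemma projective_plane_card_points:
  assumes "projective_plane k G" "k \<ge> 1"
  shows "finite (\<Union>G) \<and> card (\<Union>G) = k * (k - 1) + 1"
proof -
  have fin: "finite (\<Union>G)" using assms by (auto simp: projective_plane_def)
  have "k * card (\<Union>G) = (\<Sum>c\<in>\<Union>G. card {E \<in> G. c \<in> E})"
  proof -
    have "(\<Sum>c\<in>\<Union>G. card {E \<in> G. c \<in> E}) = (\<Sum>c\<in>\<Union>G. k)"
      using assms(1) unfolding projective_plane_def by (intro sum.cong refl) blast
    then show ?thesis by simp
  qed
  also have "\<dots> = (\<Sum>E\<in>G. card (E \<inter> \<Union>G))"
    using fin assms by (intro sum_incidences) (auto simp: projective_plane_def)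
  also have "\<dots> = (\<Sum>E\<in>G. k)"
    using assms by (intro sum.cong) (auto simp: projective_plane_def Int_absorb2 Union_upper)
  also have "\<dots> = k * (k * (k - 1) + 1)" using assms by (simp add: projective_plane_def)
  finally have "card (\<Union>G) = k * (k - 1) + 1"
    using assms(2) by (simp only: mult_cancel1) linarith
  then show ?thesis using fin by simp
qed

text \<open>Counting incidences shows that \<open>F\<close> has \<open>k\<close> points, all in the plane, and that some line meets \<open>F\<close>
  twice. If that line has a point \<open>d\<close> outside \<open>F\<close>, then the \<open>k\<close> lines through \<open>d\<close> meet \<open>F\<close> in disjoint
  nonempty sets, one of which has two points, which is too many for \<open>F\<close>.\<close>

lemma blocking_set_is_line:
  assumes G: "projective_plane k G" and k: "k \<ge> 2"
    and F: "finite F" "card F \<le> k" and block: "\<And>E. E \<in> G \<Longrightarrow> E \<inter> F \<noteq> {}"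
  shows "F \<in> G"
proof (rule ccontr)
  assume "F \<notin> G"
  note finG = projective_planeD(1)[OF G] and cG = projective_planeD(2)[OF G]
    and E = projective_planeD(3,4)[OF G] and reg = projective_planeD(5)[OF G]
    and one = projective_planeD(6)[OF G]
  have pos: "1 \<le> card (E \<inter> F)" if "E \<in> G" for E
    using block[OF that] F by (simp add: Suc_le_eq card_gt_0_iff)
  have total: "(\<Sum>E\<in>G. card (E \<inter> F)) = k * card (F \<inter> \<Union>G)"
  proof -
    have "(\<Sum>E\<in>G. card (E \<inter> F)) = (\<Sum>c\<in>F. card {E \<in> G. c \<in> E})"
      using sum_incidences[OF finG F(1)] by simp
    also have "\<dots> = (\<Sum>c\<in>F \<inter> \<Union>G. card {E \<in> G. c \<in> E})"
    proof (rule sum.mono_neutral_right)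
      show "\<forall>c\<in>F - F \<inter> \<Union> G. card {E \<in> G. c \<in> E} = 0" by (auto simp: card_eq_0_iff)
    qed (use F in auto)
    also have "\<dots> = (\<Sum>c\<in>F \<inter> \<Union>G. k)" by (rule sum.cong) (use reg in auto)
    finally show ?thesis by simp
  qed
  have "card G \<le> (\<Sum>E\<in>G. card (E \<inter> F))"
    using sum_mono[of G "\<lambda>_. 1", OF pos] by simp
  then have "k * (k - 1) < k * card (F \<inter> \<Union>G)" using total cG by linarith
  then have "k \<le> card (F \<inter> \<Union>G)" by (simp only: mult_less_cancel1) linarith
  moreover have "card (F \<inter> \<Union>G) \<le> card F" using F by (intro card_mono) auto
  ultimately have cF: "card (F \<inter> \<Union>G) = k" "card F = k" using F by auto
  have "\<exists>E\<in>G. 2 \<le> card (E \<inter> F)"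
  proof (rule ccontr)
    assume "\<not> ?thesis"
    then have "(\<Sum>E\<in>G. card (E \<inter> F)) \<le> (\<Sum>E\<in>G. 1)" by (intro sum_mono) force
    then have "k * k \<le> k * (k - 1) + 1" using total cF cG by simp
    moreover have "k * k = k * (k - 1) + k" using k by (cases k) auto
    ultimately show False using k by simp
  qed
  then obtain E0 where E0: "E0 \<in> G" "2 \<le> card (E0 \<inter> F)" by blast
  have "\<not> E0 \<subseteq> F" using card_subset_eq[OF F(1)] E[OF E0(1)] cF E0(1) \<open>F \<notin> G\<close> by metis
  then obtain d where d: "d \<in> E0" "d \<notin> F" by blast
  let ?L = "{E \<in> G. d \<in> E}"
  have cL: "card ?L = k" using reg d E0 by blast
  have disj: "(E \<inter> F) \<inter> (E' \<inter> F) = {}" if "E \<in> ?L" "E' \<in> ?L" "E \<noteq> E'" for E E'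
  proof -
    have "card (E \<inter> E') = 1" using one that by simp
    moreover have "d \<in> E \<inter> E'" using that by simp
    ultimately have "E \<inter> E' = {d}" by (metis card_1_singletonE singletonD)
    moreover have "(E \<inter> F) \<inter> (E' \<inter> F) = (E \<inter> E') \<inter> F" by blast
    ultimately show ?thesis using d(2) by simp
  qed
  have "k + 1 = (\<Sum>E\<in>?L - {E0}. 1) + 2" using cL d E0 finG k by simp
  also have "\<dots> \<le> (\<Sum>E\<in>?L - {E0}. card (E \<inter> F)) + card (E0 \<inter> F)"
    using E0 pos by (intro add_mono sum_mono) auto
  also have "\<dots> = (\<Sum>E\<in>?L. card (E \<inter> F))"
    using finG E0 d by (subst sum.remove[of ?L E0]) auto
  also have "\<dots> = card (\<Union>E\<in>?L. E \<inter> F)"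
    using finG F disj by (intro card_UN_disjoint[symmetric]) auto
  also have "\<dots> \<le> card F" using F by (intro card_mono) auto
  finally show False using cF by simp
qed

section \<open>Edge colourings in which every pair lies in many monochromatic triangles\<close>

locale codegree_colouring =
  fixes V :: "'v set" and col :: "'v \<Rightarrow> 'v \<Rightarrow> 'c" and D :: nat
  assumes finV: "finite V"
    and col_sym: "col u v = col v u"
    and mono_codegree: "\<lbrakk>u \<in> V; v \<in> V; u \<noteq> v\<rbrakk> \<Longrightarrow>
      D \<le> card {w \<in> V. w \<noteq> u \<and> w \<noteq> v \<and> col u w = col u v \<and> col v w = col u v}"
begin

definition nbr :: "'c \<Rightarrow> 'v \<Rightarrow> 'v set" where
  "nbr c v = {w \<in> V. w \<noteq> v \<and> col v w = c}"

definition seen :: "'v \<Rightarrow> 'c set" where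
  "seen v = col v ` (V - {v})"

definition spread :: "'c \<Rightarrow> 'v set" where
  "spread c = {v \<in> V. c \<in> seen v}"

lemma finite_nbr [simp]: "finite (nbr c v)" using finV by (simp add: nbr_def)
lemma finite_seen [simp]: "finite (seen v)" using finV by (simp add: seen_def)
lemma finite_spread [simp]: "finite (spread c)" using finV by (simp add: spread_def)
lemma nbr_subset: "nbr c v \<subseteq> V" by (auto simp: nbr_def)

lemma col_in_seen: "v \<in> V \<Longrightarrow> v \<noteq> u \<Longrightarrow> col u v \<in> seen u" by (auto simp: seen_def)

lemma nbr_commute: "\<lbrakk>u \<in> V; v \<in> nbr c u\<rbrakk> \<Longrightarrow> u \<in> nbr c v"
  using col_sym by (auto simp: nbr_def)

lemma nbr_subset_spread: "u \<in> V \<Longrightarrow> nbr c u \<subseteq> spread c"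
  using col_sym by (auto simp: nbr_def spread_def seen_def)

lemma nbr_nonempty_iff: "nbr c v \<noteq> {} \<longleftrightarrow> c \<in> seen v"
  by (auto simp: nbr_def seen_def)

lemma card_common_nbr:
  assumes "u \<in> V" "v \<in> nbr c u"
  shows "D \<le> card (nbr c u \<inter> nbr c v)"
proof -
  have "{w \<in> V. w \<noteq> u \<and> w \<noteq> v \<and> col u w = col u v \<and> col v w = col u v} = nbr c u \<inter> nbr c v"
    using assms by (auto simp: nbr_def)
  then show ?thesis using mono_codegree[of u v] assms by (auto simp: nbr_def)
qed

lemma Suc_le_card_nbr:
  assumes "u \<in> V" "c \<in> seen u" shows "D + 1 \<le> card (nbr c u)"
proof -
  obtain v where v: "v \<in> nbr c u" using assms nbr_nonempty_iff by blast
  then have "nbr c u \<inter> nbr c v \<subset> nbr c u" by (auto simp: nbr_def)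
  then have "card (nbr c u \<inter> nbr c v) < card (nbr c u)" by (intro psubset_card_mono) auto
  then show ?thesis using card_common_nbr[OF assms(1) v] by linarith
qed

lemma UN_nbr: "(\<Union>c\<in>seen v. nbr c v) = V - {v}"
  by (auto simp: nbr_def seen_def)

lemma card_Int_nbr_sum:
  assumes "U \<subseteq> V - {v}"
  shows "card U = (\<Sum>c\<in>seen v. card (U \<inter> nbr c v))"
proof -
  have "U = (\<Union>c\<in>seen v. U \<inter> nbr c v)" using assms UN_nbr[of v] by blast
  moreover have "card (\<Union>c\<in>seen v. U \<inter> nbr c v) = (\<Sum>c\<in>seen v. card (U \<inter> nbr c v))"
    by (rule card_UN_disjoint) (auto simp: nbr_def finV)
  ultimately show ?thesis by simp
qed

lemma sum_card_nbr:
  assumes "v \<in> V" shows "(\<Sum>c\<in>seen v. card (nbr c v)) = card V - 1"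
proof -
  have "(V - {v}) \<inter> nbr c v = nbr c v" for c by (auto simp: nbr_def)
  then show ?thesis using card_Int_nbr_sum[of "V - {v}" v] assms finV by simp
qed

lemma card_seen_mult_le:
  assumes "v \<in> V" shows "card (seen v) * (D + 1) \<le> card V - 1"
  using sum_mono[of "seen v" "\<lambda>_. D + 1" "\<lambda>c. card (nbr c v)"] Suc_le_card_nbr[OF assms]
    sum_card_nbr[OF assms] by simp

lemma seen_nonempty:
  assumes "card V \<ge> 2" "v \<in> V" shows "seen v \<noteq> {}"
proof
  assume "seen v = {}"
  then have "V = {v}" using assms(2) by (auto simp: seen_def)
  then show False using assms(1) by simp
qed

lemma seen_intersect:
  assumes "card V \<ge> 2" "u \<in> V" "v \<in> V" shows "seen u \<inter> seen v \<noteq> {}"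
proof (cases "u = v")
  case False
  then have "col u v \<in> seen u" "col v u \<in> seen v" using assms by (auto intro: col_in_seen)
  then show ?thesis using col_sym by fastforce
qed (use seen_nonempty assms in auto)

lemma card_le_card_seen_mult:
  assumes "card V \<ge> 2" "v \<in> V" and M: "\<And>c. card (spread c) \<le> M"
  shows "card V \<le> card (seen v) * M"
proof -
  have "V \<subseteq> (\<Union>c\<in>seen v. spread c)"
    using seen_intersect[OF assms(1) _ assms(2)] by (auto simp: spread_def)
  then have "card V \<le> card (\<Union>c\<in>seen v. spread c)" by (intro card_mono) auto
  also have "\<dots> \<le> (\<Sum>c\<in>seen v. card (spread c))" by (rule card_UN_le) simp
  also have "\<dots> \<le> (\<Sum>c\<in>seen v. M)" by (rule sum_mono) (rule M)
  finally show ?thesis by simp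
qed

lemma sum_card_spread:
  assumes "finite S" and "\<And>v. v \<in> V \<Longrightarrow> seen v \<subseteq> S"
  shows "(\<Sum>c\<in>S. card (spread c)) = (\<Sum>v\<in>V. card (seen v))"
proof -
  have "(\<Sum>c\<in>S. card (spread c)) = (\<Sum>c\<in>S. \<Sum>v\<in>V. of_bool (c \<in> seen v))"
    using finV by (simp only: sum_of_bool_eq_card of_nat_id spread_def)
  also have "\<dots> = (\<Sum>v\<in>V. \<Sum>c\<in>S. of_bool (c \<in> seen v))" by (rule sum.swap)
  also have "\<dots> = (\<Sum>v\<in>V. card {c \<in> S. c \<in> seen v})"
    using assms(1) by (simp only: sum_of_bool_eq_card of_nat_id)
  also have "\<dots> = (\<Sum>v\<in>V. card (seen v))"
    using assms(2) by (intro sum.cong refl arg_cong[of _ _ card]) auto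
  finally show ?thesis .
qed

text \<open>The common neighbourhoods of the three sides of a rainbow triangle are disjoint and avoid its
  vertices, so there is no rainbow triangle. Each vertex sees at most two colours. If no colour
  spans, then \<open>u\<close> sees two colours \<open>a\<close> and \<open>b\<close>, some \<open>v\<close> misses \<open>a\<close> and some \<open>w\<close> misses \<open>b\<close>,
  and \<open>u\<close>, \<open>v\<close>, \<open>w\<close> form a rainbow triangle.\<close>

lemma spanning_colour:
  assumes "card V \<ge> 2" and big: "card V < 3 * D + 3"
  shows "\<exists>c. spread c = V"
proof (rule ccontr)
  assume no: "\<nexists>c. spread c = V"
  have miss: "\<exists>v\<in>V. c \<notin> seen v" for c using no by (auto simp: spread_def)
  have two: "card (seen v) \<le> 2" if "v \<in> V" for v
  proof (rule ccontr)
    assume "\<not> ?thesis"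
    then have "3 * (D + 1) \<le> card (seen v) * (D + 1)" by (intro mult_right_mono) auto
    then have "3 * (D + 1) \<le> card V - 1" using card_seen_mult_le[OF that] by (rule order_trans)
    then show False using big assms(1) by arith
  qed
  obtain u where u: "u \<in> V" using assms(1) by fastforce
  obtain a where a: "a \<in> seen u" using seen_nonempty[OF assms(1) u] by blast
  obtain v where v: "v \<in> V" "a \<notin> seen v" using miss by blast
  have uv: "u \<noteq> v" using a v by blast
  define b where "b = col u v"
  have b: "b \<in> seen u" "b \<in> seen v"
    using col_in_seen[of v u] col_in_seen[of u v] u v uv col_sym by (auto simp: b_def)
  have ab: "a \<noteq> b" using b v by blast
  have seen_u: "seen u = {a, b}"
    using card_seteq[of "seen u" "{a, b}"] a b ab two[OF u] by simp
  obtain w where w: "w \<in> V" "b \<notin> seen w" using miss by blast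
  have uw: "u \<noteq> w" using b w by blast
  have vw: "v \<noteq> w" using b w by blast
  have "col u w \<in> seen u" "col u w \<in> seen w"
    using col_in_seen[of w u] col_in_seen[of u w] u w uw col_sym[of u w] by auto
  then have cuw: "col u w = a" using seen_u w by auto
  define c where "c = col v w"
  have "c \<in> seen v" "c \<in> seen w"
    using col_in_seen[of w v] col_in_seen[of v w] v w vw col_sym[of v w] by (auto simp: c_def)
  then have ca: "c \<noteq> a" and cb: "c \<noteq> b" using v w by auto
  let ?A = "nbr b u \<inter> nbr b v" and ?B = "nbr a u \<inter> nbr a w" and ?C = "nbr c v \<inter> nbr c w"
  have "D \<le> card ?A" using u v uv by (intro card_common_nbr) (auto simp: nbr_def b_def)
  moreover have "D \<le> card ?B" using u w uw cuw by (intro card_common_nbr) (auto simp: nbr_def)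
  moreover have "D \<le> card ?C" using v w vw by (intro card_common_nbr) (auto simp: nbr_def c_def)
  moreover have "card (?A \<union> ?B \<union> ?C) = card ?A + card ?B + card ?C"
    using ab ca cb by (subst card_Un_disjoint, simp, simp, force simp: nbr_def)+ simp
  moreover have "?A \<union> ?B \<union> ?C \<subseteq> V - {u, v, w}"
    using ab ca cb cuw col_sym b_def c_def by (auto simp: nbr_def)
  then have "card (?A \<union> ?B \<union> ?C) \<le> card (V - {u, v, w})" using finV by (intro card_mono) auto
  moreover have "card (V - {u, v, w}) = card V - 3"
    using u v w uv uw vw finV by (subst card_Diff_subset) auto
  moreover have "card V \<ge> 3" using card_mono[of V "{u, v, w}"] u v w uv uw vw finV by auto
  ultimately show False using big by linarith
qed

text \<open>Let \<open>e c\<close> be the excess over \<open>D\<close> of the number of \<open>c\<close>-neighbours of \<open>v\<close>. Every \<open>c\<close>-neighbour of \<open>v\<close> is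
  a \<open>c\<close>-neighbour of all but \<open>e c\<close> vertices of \<open>nbr c v\<close>, and the excesses sum to
  \<open>eps = card V - 1 - r * D < D\<close>.

  Let \<open>z\<close> see \<open>j\<close>. It has a \<open>j\<close>-neighbour \<open>y\<close> that lies in another colour neighbourhood of \<open>v\<close> than \<open>z\<close>.
  The at least \<open>D\<close> common \<open>j\<close>-neighbours of \<open>z\<close> and \<open>y\<close> almost avoid the two neighbourhoods of \<open>v\<close> that
  contain \<open>z\<close> and \<open>y\<close>, so they have a share of more than \<open>(D - eps) / (r - 2)\<close> in one of the other
  \<open>r - 2\<close>. A vertex \<open>w\<close> of this share is not joined in colour \<open>j\<close> to most of the share, so \<open>z\<close> has
  at least \<open>(D - eps) / (r - 2)\<close> \<open>j\<close>-neighbours that are not \<open>j\<close>-neighbours of \<open>w\<close>.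

  Together with the \<open>D\<close> common neighbours, every vertex seeing \<open>j\<close> thus has \<open>j\<close>-degree at least
  \<open>D + (D - eps) / (r - 2)\<close>, and joining the \<open>j\<close>-neighbourhoods of \<open>z\<close> and \<open>w\<close> gives another
  \<open>(D - eps) / (r - 2)\<close> vertices.\<close>

lemma spread_large_of_rich_vertex:
  assumes v: "v \<in> V" and r: "card (seen v) = r" "r \<ge> 3" and n: "card V \<le> (r + 1) * D"
    and j: "j \<notin> seen v" "spread j \<noteq> {}"
  shows "3 * r * D \<le> 2 * card V + (r - 2) * card (spread j)"
proof -
  define e where "e c = int (card (nbr c v)) - int D" for c
  define eps where "eps = int (card V) - 1 - int r * int D"
  have e1: "1 \<le> e c" if "c \<in> seen v" for c
    using Suc_le_card_nbr[OF v that] by (simp add: e_def)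
  have "card V \<ge> 1" using v finV by (simp add: Suc_le_eq card_gt_0_iff) blast
  then have sum_e: "(\<Sum>c\<in>seen v. e c) = eps"
    using sum_card_nbr[OF v] r(1)
    by (simp add: e_def eps_def sum_subtractf of_nat_diff flip: of_nat_sum)
  have eD: "eps < int D" using n by (simp add: eps_def algebra_simps flip: of_nat_mult of_nat_add)
  have e_eps: "e c \<le> eps" if "c \<in> seen v" for c
    unfolding sum_e[symmetric] using that e1 by (intro member_le_sum) force+
  have miss: "int (card (nbr c v - nbr c z)) \<le> e c" if "z \<in> nbr c v" for c z
    using card_common_nbr[OF v that] card_Int_Diff[of "nbr c v" "nbr c z"] by (simp add: e_def)
  have step: "\<exists>w\<in>nbr j z. int D - eps \<le> int (r - 2) * int (card (nbr j z - nbr j w))"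
    if z: "z \<in> spread j" for z
  proof -
    have zV: "z \<in> V" and jz: "j \<in> seen z" and zv: "z \<noteq> v" using z j by (auto simp: spread_def)
    have v_nbr: "v \<notin> nbr j z" using nbr_commute[OF zV, of v j] nbr_nonempty_iff[of j v] j by auto
    define k where "k = col v z"
    have k: "k \<in> seen v" "z \<in> nbr k v" using zV zv by (auto simp: k_def col_in_seen nbr_def)
    \<comment> \<open>A vertex of \<open>nbr c v\<close> joined to \<open>y\<close> in colour \<open>j\<close> is not a \<open>c\<close>-neighbour of \<open>y\<close>.\<close>
    have few: "int (card (U \<inter> nbr c v)) \<le> e c"
      if "U \<subseteq> nbr j y" "y \<in> nbr c v" "c \<in> seen v" for U y c
    proof -
      have "U \<inter> nbr c v \<subseteq> nbr c v - nbr c y" using that j by (auto simp: nbr_def)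
      then have "card (U \<inter> nbr c v) \<le> card (nbr c v - nbr c y)" by (intro card_mono) auto
      then show ?thesis using miss[OF that(2)] by linarith
    qed
    have "int (card (nbr j z \<inter> nbr k v)) < int (card (nbr j z))"
      using few[OF subset_refl k(2,1)] e_eps[OF k(1)] eD Suc_le_card_nbr[OF zV jz] by linarith
    then have "\<not> nbr j z \<subseteq> nbr k v" by (metis inf.absorb1 less_irrefl)
    then obtain y where y: "y \<in> nbr j z" "y \<notin> nbr k v" by blast
    have yV: "y \<in> V" and yv: "y \<noteq> v" using y v_nbr by (auto simp: nbr_def)
    define c where "c = col v y"
    have c: "c \<in> seen v" "y \<in> nbr c v" using yV yv by (auto simp: c_def col_in_seen nbr_def)
    have ck: "c \<noteq> k" using y c by blast
    define S where "S = nbr j z \<inter> nbr j y"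
    have SD: "D \<le> card S" unfolding S_def by (rule card_common_nbr[OF zV y(1)])
    let ?R = "seen v - {k, c}" and ?x = "\<lambda>c'. int (card (S \<inter> nbr c' v)) - e c'"
    have cardR: "card ?R = r - 2" using k c ck r by (simp add: card_Diff_subset)
    have split: "(\<Sum>c'\<in>seen v. f c') = (\<Sum>c'\<in>?R. f c') + f k + f c" for f :: "'c \<Rightarrow> int"
    proof -
      have "seen v = insert k (insert c ?R)" using k c by blast
      then have "(\<Sum>c'\<in>seen v. f c') = (\<Sum>c'\<in>insert k (insert c ?R). f c')" by simp
      then show ?thesis using ck by simp
    qed
    have "S \<subseteq> V - {v}" using v_nbr nbr_subset by (auto simp: S_def)
    then have "int (card S) = (\<Sum>c'\<in>seen v. int (card (S \<inter> nbr c' v)))"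
      by (simp add: card_Int_nbr_sum[of S v])
    then have "(\<Sum>c'\<in>seen v. ?x c') = int (card S) - eps"
      by (simp add: sum_subtractf sum_e)
    moreover have "?x k \<le> 0" using few[of S z k] k by (simp add: S_def)
    moreover have "?x c \<le> 0" using few[of S y c] c by (simp add: S_def)
    ultimately have tot: "int D - eps \<le> (\<Sum>c'\<in>?R. ?x c')"
      using split[of ?x] SD by linarith
    have "\<exists>c'\<in>?R. int D - eps \<le> int (r - 2) * ?x c'"
    proof (rule ccontr)
      assume "\<not> ?thesis"
      then have lt: "int (r - 2) * ?x c' < int D - eps" if "c' \<in> ?R" for c' using that by force
      have "?R \<noteq> {}" using cardR r(2) by (metis card.empty diff_is_0_eq not_less_eq_eq numeral_2_eq_2 numeral_3_eq_3)
      then have "(\<Sum>c'\<in>?R. int (r - 2) * ?x c') < (\<Sum>c'\<in>?R. int D - eps)"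
        by (intro sum_strict_mono lt) auto
      then have "int (r - 2) * (\<Sum>c'\<in>?R. ?x c') < int (r - 2) * (int D - eps)"
        using cardR by (simp add: sum_distrib_left)
      then show False using tot by (simp add: mult_less_cancel_left)
    qed
    then obtain c' where c': "c' \<in> seen v" "int D - eps \<le> int (r - 2) * ?x c'" by blast
    then have "0 < int (r - 2) * ?x c'" using eD by linarith
    then have "0 < ?x c'" by (simp add: zero_less_mult_iff)
    then have "card (S \<inter> nbr c' v) \<noteq> 0" using e1[OF c'(1)] by linarith
    then obtain w where w: "w \<in> S" "w \<in> nbr c' v" by (metis Int_iff card.empty equals0I)
    \<comment> \<open>A \<open>c'\<close>-neighbour of \<open>w\<close> is not a \<open>j\<close>-neighbour of \<open>w\<close>.\<close>
    have "S \<inter> nbr c' v - (nbr c' v - nbr c' w) \<subseteq> nbr j z - nbr j w"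
      using j c' by (auto simp: S_def nbr_def)
    then have "card (S \<inter> nbr c' v - (nbr c' v - nbr c' w)) \<le> card (nbr j z - nbr j w)"
      by (intro card_mono) auto
    moreover have "card (S \<inter> nbr c' v) - card (nbr c' v - nbr c' w)
        \<le> card (S \<inter> nbr c' v - (nbr c' v - nbr c' w))"
      by (rule diff_card_le_card_Diff) simp
    ultimately have "?x c' \<le> int (card (nbr j z - nbr j w))" using miss[OF w(2)] by linarith
    then have "int (r - 2) * ?x c' \<le> int (r - 2) * int (card (nbr j z - nbr j w))"
      by (intro mult_left_mono) auto
    then show ?thesis using c'(2) w(1) by (intro bexI[of _ w]) (auto simp: S_def)
  qed
  obtain z where z: "z \<in> spread j" using j by blast
  then have zV: "z \<in> V" by (simp add: spread_def)
  obtain w where w: "w \<in> nbr j z" "int D - eps \<le> int (r - 2) * int (card (nbr j z - nbr j w))"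
    using step[OF z] by blast
  have ws: "w \<in> spread j" and wV: "w \<in> V"
    using w nbr_subset_spread[OF zV, of j] nbr_subset by auto
  obtain x where x: "x \<in> nbr j w" "int D - eps \<le> int (r - 2) * int (card (nbr j w - nbr j x))"
    using step[OF ws] by blast
  have "card (nbr j w) = card (nbr j w \<inter> nbr j x) + card (nbr j w - nbr j x)"
    by (simp add: card_Int_Diff)
  then have dw: "D + card (nbr j w - nbr j x) \<le> card (nbr j w)"
    using card_common_nbr[OF wV x(1)] by linarith
  have "nbr j w \<union> (nbr j z - nbr j w) \<subseteq> spread j"
    using nbr_subset_spread[OF zV, of j] nbr_subset_spread[OF wV, of j] by blast
  then have "card (nbr j w \<union> (nbr j z - nbr j w)) \<le> card (spread j)" by (intro card_mono) auto
  moreover have "card (nbr j w \<union> (nbr j z - nbr j w)) = card (nbr j w) + card (nbr j z - nbr j w)"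
    by (rule card_Un_disjoint) auto
  ultimately have "int D + int (card (nbr j w - nbr j x)) + int (card (nbr j z - nbr j w))
      \<le> int (card (spread j))" using dw by linarith
  then have "int (r - 2) * (int D + int (card (nbr j w - nbr j x)) + int (card (nbr j z - nbr j w)))
      \<le> int (r - 2) * int (card (spread j))" by (intro mult_left_mono) auto
  then have "int (r - 2) * int D + 2 * (int D - eps) \<le> int (r - 2) * int (card (spread j))"
    using w(2) x(2) by (simp add: algebra_simps)
  then have "3 * int r * int D \<le> 2 * int (card V) + int (r - 2) * int (card (spread j))"
    using r(2) by (simp add: eps_def of_nat_diff algebra_simps)
  then have "int (3 * r * D) \<le> int (2 * card V + (r - 2) * card (spread j))" by simp
  then show ?thesis by (simp only: of_nat_le_iff)
qed

end

text \<open>Sum the hypothesis over all ordered pairs and divide by \<open>k - 1\<close>.\<close>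

lemma sum_off_diagonal_bound:
  fixes D :: nat
  assumes "finite A" "card A = k" "k \<ge> 2"
    and le: "\<And>x y. x \<in> A \<Longrightarrow> y \<in> A \<Longrightarrow> x \<noteq> y \<Longrightarrow> D + h y \<le> d x"
  shows "k * D + (\<Sum>y\<in>A. h y) \<le> (\<Sum>x\<in>A. d x)"
proof -
  have inner: "(k - 1) * D + (\<Sum>y\<in>A - {x}. h y) \<le> (k - 1) * d x" if "x \<in> A" for x
  proof -
    have "(\<Sum>y\<in>A - {x}. D + h y) \<le> (\<Sum>y\<in>A - {x}. d x)" using le that by (intro sum_mono) auto
    then show ?thesis using assms that by (simp add: sum.distrib)
  qed
  have h: "(\<Sum>y\<in>A - {x}. h y) + h x = sum h A" if "x \<in> A" for x
    using sum.remove[OF assms(1) that, of h] by simp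
  have "(\<Sum>x\<in>A. (k - 1) * D + sum h A) = (\<Sum>x\<in>A. (k - 1) * D + (\<Sum>y\<in>A - {x}. h y) + h x)"
    using h by (intro sum.cong) (auto simp: add.assoc)
  also have "\<dots> \<le> (\<Sum>x\<in>A. (k - 1) * d x + h x)"
    using inner by (intro sum_mono add_right_mono) auto
  finally have "k * ((k - 1) * D + sum h A) \<le> (k - 1) * sum d A + sum h A"
    using assms(2) by (simp add: sum.distrib sum_distrib_left)
  moreover have "k * ((k - 1) * D + sum h A) = (k - 1) * (k * D + sum h A) + sum h A"
    using assms(3) by (cases k) (auto simp: algebra_simps)
  ultimately have "(k - 1) * (k * D + sum h A) \<le> (k - 1) * sum d A" by linarith
  then show ?thesis using assms(3) by simp
qed

context codegree_colouring begin

text \<open>Group the vertices into parts according to the set of colours that they see, with one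
  representative for each part; the parts are the lines of the plane and the colours its points.
  Two different parts \<open>E\<close> and \<open>F\<close> share exactly one colour \<open>c\<close>, so all pairs between them have colour
  \<open>c\<close>. The \<open>c\<close>-neighbours of the representative of \<open>E\<close> therefore include all of \<open>F\<close>, of which
  \<open>h F c\<close> are no \<open>c\<close>-neighbours of the representative of \<open>F\<close>. Within its own part the representative
  of \<open>F\<close> has one colour for each neighbour, so \<open>h F c\<close> is large on average over \<open>c\<close>. Summing over all
  \<open>c\<close>, \<open>E\<close>, \<open>F\<close> gives the bound.\<close>

lemma projective_plane_codegree_bound:
  assumes n: "card V \<ge> 2" and k: "k \<ge> 2" and G: "projective_plane k (seen ` V)"
  shows "k * (k * (k - 1) + 1) * D + (k - 1) * card V \<le> (k * (k - 1) + 1) * (card V - 1)"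
proof -
  let ?G = "seen ` V"
  note finG = projective_planeD(1)[OF G] and cG = projective_planeD(2)[OF G]
    and E = projective_planeD(4)[OF G] and reg = projective_planeD(5)[OF G]
    and one = projective_planeD(6)[OF G]
  have cU: "finite (\<Union>?G)" "card (\<Union>?G) = k * (k - 1) + 1"
    using projective_plane_card_points[OF G] k by simp_all
  define part where "part E = {u \<in> V. seen u = E}" for E
  define rep where "rep E = (SOME u. u \<in> part E)" for E
  define h where "h E c = card (part E - nbr c (rep E))" for E c
  have rep: "rep E \<in> part E" if "E \<in> ?G" for E
  proof -
    have "\<exists>u. u \<in> part E" using that by (auto simp: part_def)
    then show ?thesis unfolding rep_def by (rule someI_ex)
  qed
  have repV: "rep E \<in> V" "seen (rep E) = E" if "E \<in> ?G" for E
    using rep[OF that] by (auto simp: part_def)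
  have fin_part: "finite (part E)" for E using finV by (simp add: part_def)
  have flag: "D + h F c \<le> card (nbr c (rep E))"
    if EF: "E \<in> ?G" "F \<in> ?G" "E \<noteq> F" and c: "c \<in> E" "c \<in> F" for E F c
  proof -
    have "E \<inter> F = {c}" using one[OF EF] c by (metis IntI card_1_singletonE singletonD)
    have sub: "part F \<subseteq> nbr c (rep E)"
    proof
      fix u assume u: "u \<in> part F"
      then have uV: "u \<in> V" "seen u = F" by (auto simp: part_def)
      then have ne: "u \<noteq> rep E" using repV EF by auto
      then have "col (rep E) u \<in> E \<inter> F"
        using col_in_seen[of u "rep E"] col_in_seen[of "rep E" u] uV repV[OF EF(1)] col_sym by auto
      then have "col (rep E) u = c" using \<open>E \<inter> F = {c}\<close> by blast
      then show "u \<in> nbr c (rep E)" using uV ne by (simp add: nbr_def)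
    qed
    have "D \<le> card (nbr c (rep E) \<inter> nbr c (rep F))"
      using card_common_nbr[OF repV(1)[OF EF(1)]] sub rep[OF EF(2)] by blast
    moreover have "h F c \<le> card (nbr c (rep E) - nbr c (rep F))"
      unfolding h_def using sub by (intro card_mono) auto
    ultimately show ?thesis using card_Int_Diff[of "nbr c (rep E)" "nbr c (rep F)"] by simp
  qed
  have colour: "k * D + (\<Sum>F\<in>{F \<in> ?G. c \<in> F}. h F c) \<le> (\<Sum>E\<in>{E \<in> ?G. c \<in> E}. card (nbr c (rep E)))"
    if "c \<in> \<Union>?G" for c
    using flag finG by (intro sum_off_diagonal_bound reg[OF that] k) auto
  have swap: "(\<Sum>c\<in>\<Union>?G. \<Sum>E\<in>{E \<in> ?G. c \<in> E}. f E c) = (\<Sum>E\<in>?G. \<Sum>c\<in>E. f E c)"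
    for f :: "'c set \<Rightarrow> 'c \<Rightarrow> nat"
  proof -
    have "(\<Sum>c\<in>\<Union>?G. \<Sum>E\<in>{E \<in> ?G. c \<in> E}. f E c) = (\<Sum>E\<in>?G. \<Sum>c\<in>{c \<in> \<Union>?G. c \<in> E}. f E c)"
      by (rule sum.swap_restrict[OF cU(1) finG])
    also have "\<dots> = (\<Sum>E\<in>?G. \<Sum>c\<in>E. f E c)" by (intro sum.cong refl) blast
    finally show ?thesis .
  qed
  have h_sum: "(k - 1) * card (part E) \<le> (\<Sum>c\<in>E. h E c)" if EG: "E \<in> ?G" for E
  proof -
    have "card (part E) - 1 = card (part E - {rep E})"
      by (rule card_Diff_singleton[OF rep[OF EG], symmetric])
    also have "\<dots> = (\<Sum>c\<in>E. card ((part E - {rep E}) \<inter> nbr c (rep E)))"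
      using card_Int_nbr_sum[of "part E - {rep E}" "rep E"] repV[OF EG] by (auto simp: part_def)
    also have "\<dots> = (\<Sum>c\<in>E. card (part E \<inter> nbr c (rep E)))"
      by (intro sum.cong refl arg_cong[of _ _ card]) (auto simp: nbr_def)
    finally have a: "card (part E) - 1 = (\<Sum>c\<in>E. card (part E \<inter> nbr c (rep E)))" .
    have "k * card (part E) = (\<Sum>c\<in>E. card (part E \<inter> nbr c (rep E)) + h E c)"
      using E[OF EG] card_Int_Diff[OF fin_part] by (simp add: h_def)
    also have "\<dots> = card (part E) - 1 + (\<Sum>c\<in>E. h E c)" by (simp only: sum.distrib a)
    finally show ?thesis by (simp add: diff_mult_distrib)
  qed
  have "card V = card (\<Union>E\<in>?G. part E)" by (rule arg_cong[of _ _ card]) (auto simp: part_def)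
  also have "\<dots> = (\<Sum>E\<in>?G. card (part E))"
    using finG fin_part by (intro card_UN_disjoint) (auto simp: part_def)
  finally have nV: "card V = (\<Sum>E\<in>?G. card (part E))" .
  have "k * (k * (k - 1) + 1) * D + (k - 1) * card V
      \<le> (\<Sum>c\<in>\<Union>?G. k * D) + (\<Sum>E\<in>?G. \<Sum>c\<in>E. h E c)"
  proof (rule add_mono)
    show "k * (k * (k - 1) + 1) * D \<le> (\<Sum>c\<in>\<Union>?G. k * D)" by (simp only: sum_constant cU(2) of_nat_id mult_ac order_refl)
    show "(k - 1) * card V \<le> (\<Sum>E\<in>?G. \<Sum>c\<in>E. h E c)"
      unfolding nV sum_distrib_left by (intro sum_mono h_sum)
  qed
  also have "\<dots> = (\<Sum>c\<in>\<Union>?G. k * D + (\<Sum>F\<in>{F \<in> ?G. c \<in> F}. h F c))"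
    by (simp only: sum.distrib swap)
  also have "\<dots> \<le> (\<Sum>c\<in>\<Union>?G. \<Sum>E\<in>{E \<in> ?G. c \<in> E}. card (nbr c (rep E)))"
    by (intro sum_mono colour)
  also have "\<dots> = (\<Sum>E\<in>?G. \<Sum>c\<in>E. card (nbr c (rep E)))" by (rule swap)
  also have "\<dots> = (\<Sum>E\<in>?G. card V - 1)"
    using sum_card_nbr repV by (intro sum.cong refl) metis
  also have "\<dots> = (k * (k - 1) + 1) * (card V - 1)" by (simp only: sum_constant cG of_nat_id)
  finally show ?thesis .
qed

text \<open>Weight each set of colours by the number of vertices that see exactly this set. The load of a
  colour is then the number of vertices that see it.\<close>

lemma projective_plane_or_spread_large:
  assumes n: "card V \<ge> 2" and k: "k \<ge> 2" and few: "\<And>v. v \<in> V \<Longrightarrow> card (seen v) \<le> k"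
    and M: "\<And>c. card (spread c) \<le> M"
  shows "card V \<le> (k - 1) * M \<or> projective_plane k (seen ` V)"
proof -
  let ?H = "seen ` V"
  define w where "w E = real (card {v \<in> V. seen v = E})" for E
  have load: "load ?H w c = real (card (spread c))" for c
  proof -
    have "load ?H w c = (\<Sum>E\<in>?H. \<Sum>v\<in>{v \<in> V. seen v = E}. of_bool (c \<in> seen v))"
      unfolding load_def w_def by (intro sum.cong refl) simp
    also have "\<dots> = (\<Sum>v\<in>V. of_bool (c \<in> seen v))"
      by (rule sum.image_gen[OF finV, symmetric])
    also have "\<dots> = real (card (spread c))"
      using finV by (simp only: sum_of_bool_eq_card spread_def)
    finally show ?thesis .
  qed
  have sum_w: "sum w ?H = real (card V)"
    using sum.image_gen[OF finV, of "\<lambda>_. 1::real" seen] by (simp add: w_def)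
  have "card V \<le> k * M"
  proof -
    obtain v where "v \<in> V" using n by fastforce
    then have "card V \<le> card (seen v) * M" "card (seen v) \<le> k"
      using card_le_card_seen_mult[OF n _ M] few by auto
    then show ?thesis by (meson mult_le_mono1 order_trans)
  qed
  then have "M > 0" using n by (cases M) auto
  have "sum w ?H \<le> real (k - 1) * real M \<or> (\<exists>G\<subseteq>?H. projective_plane k G)"
  proof (rule furedi_dichotomy)
    show "fractional_matching ?H (real M) w"
      using M by (simp add: fractional_matching_def load w_def)
  qed (use finV few k \<open>M > 0\<close> seen_intersect[OF n] in auto)
  then show ?thesis
  proof
    assume "sum w ?H \<le> real (k - 1) * real M"
    then have "card V \<le> (k - 1) * M" unfolding sum_w by (simp flip: of_nat_mult)
    then show ?thesis ..
  next
    assume "\<exists>G\<subseteq>?H. projective_plane k G"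
    then obtain G where G: "G \<subseteq> ?H" "projective_plane k G" by blast
    have "F \<in> G" if "F \<in> ?H" for F
    proof (rule blocking_set_is_line[OF G(2) k])
      show "finite F" "card F \<le> k" using that few by auto
      show "E \<inter> F \<noteq> {}" if "E \<in> G" for E using that \<open>F \<in> ?H\<close> G(1) seen_intersect[OF n] by blast
    qed
    then have "?H = G" using G(1) by blast
    then show ?thesis using G(2) by simp
  qed
qed

text \<open>The second alternative cannot be dropped: for three parts of equal size, with three colours that
  each miss one of the parts, \<open>D\<close> can be close to \<open>card V / 3\<close> while \<open>M\<close> is \<open>2 * card V / 3\<close>.\<close>

theorem spread_lower_bound:
  assumes r: "r \<ge> 3" and n: "card V \<ge> 2" "r * D \<le> card V" "card V \<le> (r + 1) * D"
    and M: "\<And>c. card (spread c) \<le> M"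
  shows "3 * r * D \<le> 2 * card V + (r - 2) * M \<or> r = 3 \<and> 2 * card V \<le> 3 * M"
proof -
  have enough: ?thesis if "card V \<le> (r - 2) * M" using that n(2) by (simp add: mult.assoc)
  have le_r: "card (seen v) \<le> r" if "v \<in> V" for v
  proof (rule ccontr)
    assume "\<not> ?thesis"
    then have "(r + 1) * (D + 1) \<le> card (seen v) * (D + 1)" by (intro mult_right_mono) auto
    then show False using card_seen_mult_le[OF that] n(1,3) by (simp add: algebra_simps)
  qed
  consider (poor) v where "v \<in> V" "card (seen v) \<le> r - 2"
    | (rich) v where "v \<in> V" "card (seen v) = r" "\<And>u. u \<in> V \<Longrightarrow> r - 1 \<le> card (seen u)"
    | (middle) "\<And>v. v \<in> V \<Longrightarrow> card (seen v) \<le> r - 1"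
  proof (cases "\<exists>v\<in>V. card (seen v) \<le> r - 2")
    case False
    then have ge: "r - 1 \<le> card (seen u)" if "u \<in> V" for u using that by force
    show ?thesis
    proof (cases "\<exists>v\<in>V. card (seen v) = r")
      case True
      then show ?thesis using that(2) ge by blast
    next
      case False
      then have "card (seen v) \<le> r - 1" if "v \<in> V" for v using le_r[OF that] that by fastforce
      then show ?thesis by (rule that(3))
    qed
  qed blast
  then show ?thesis
  proof cases
    case poor
    have "card V \<le> card (seen v) * M" by (rule card_le_card_seen_mult[OF n(1) poor(1) M])
    also have "\<dots> \<le> (r - 2) * M" using poor(2) by simp
    finally show ?thesis by (rule enough)
  next
    case rich
    show ?thesis
    proof (cases "\<exists>j. j \<notin> seen v \<and> spread j \<noteq> {}")
      case True
      then obtain j where "j \<notin> seen v" "spread j \<noteq> {}" by blast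
      from spread_large_of_rich_vertex[OF rich(1,2) r n(3) this]
      have "3 * r * D \<le> 2 * card V + (r - 2) * card (spread j)" .
      also have "\<dots> \<le> 2 * card V + (r - 2) * M" using M by simp
      finally show ?thesis ..
    next
      case False
      then have sub: "seen u \<subseteq> seen v" if "u \<in> V" for u using that by (auto simp: spread_def)
      have "(r - 1) * card V = (\<Sum>u\<in>V. r - 1)" by simp
      also have "\<dots> \<le> (\<Sum>u\<in>V. card (seen u))" using rich(3) by (rule sum_mono)
      also have "\<dots> = (\<Sum>c\<in>seen v. card (spread c))" using sum_card_spread[OF _ sub] by simp
      also have "\<dots> \<le> (\<Sum>c\<in>seen v. M)" using M by (rule sum_mono)
      also have "\<dots> = r * M" using rich(2) by simp
      finally have rM: "(r - 1) * card V \<le> r * M" .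
      show ?thesis
      proof (cases "r = 3")
        case True
        then show ?thesis using rM by simp
      next
        case False
        then obtain s where s: "r = s + 4" using r le_Suc_ex[of 4 r] by (auto simp: add.commute)
        have "r * card V \<le> (r - 2) * ((r - 1) * card V)" by (simp add: s algebra_simps)
        also have "\<dots> \<le> (r - 2) * (r * M)" using rM by (rule mult_left_mono) simp
        finally have "r * card V \<le> r * ((r - 2) * M)" by (simp add: algebra_simps)
        then have "card V \<le> (r - 2) * M" using r by simp
        then show ?thesis by (rule enough)
      qed
    qed
  next
    case middle
    define k where "k = r - 1"
    have k: "k \<ge> 2" "r = k + 1" "r - 2 = k - 1" using r by (auto simp: k_def)
    from projective_plane_or_spread_large[OF n(1) k(1) _ M] middle
    consider "card V \<le> (k - 1) * M" | (plane) "projective_plane k (seen ` V)"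
      unfolding k_def by blast
    then show ?thesis
    proof cases
      case 1
      then show ?thesis using enough k by simp
    next
      case plane
      define N where "N = k * (k - 1) + 1"
      have "(\<Sum>c\<in>\<Union>(seen ` V). card (spread c)) = (\<Sum>v\<in>V. card (seen v))"
        using finV by (intro sum_card_spread) auto
      also have "\<dots> = k * card V" using plane by (simp add: projective_plane_def)
      finally have "k * card V = (\<Sum>c\<in>\<Union>(seen ` V). card (spread c))" ..
      also have "\<dots> \<le> (\<Sum>c\<in>\<Union>(seen ` V). M)" using M by (rule sum_mono)
      also have "\<dots> = N * M" using projective_plane_card_points[OF plane] k by (simp add: N_def)
      finally have NM: "k * card V \<le> N * M" .
      have ND: "k * N * D + (k - 1) * card V \<le> N * card V"
      proof -
        have "k * N * D + (k - 1) * card V \<le> N * (card V - 1)"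
          using projective_plane_codegree_bound[OF n(1) k(1) plane] by (simp add: N_def)
        also have "\<dots> \<le> N * card V" by simp
        finally show ?thesis .
      qed
      show ?thesis
      proof (cases "r = 3")
        case True
        then show ?thesis using NM k by (simp add: N_def)
      next
        case False
        then obtain s where s: "k = s + 3" using k r le_Suc_ex[of 3 k] by (auto simp: add.commute)
        \<comment> \<open>With \<open>N = k * (k - 1) + 1\<close>, the upper bound on \<open>D\<close> and the lower bound on \<open>M\<close> combine because
          \<open>3 * (k + 1) * (N - k + 1) \<le> 2 * k * N + k * k * (k - 1)\<close> for \<open>k \<ge> 3\<close>.\<close>
        have chain: "a \<le> b + w" if "a + x \<le> y" "z \<le> w" "y \<le> x + b + z" for a b w x y z :: nat
          using that by linarith
        have "k * N * (3 * (k + 1) * D) + 3 * (k + 1) * ((k - 1) * card V) \<le> 3 * (k + 1) * (N * card V)"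
          using mult_left_mono[OF ND, of "3 * (k + 1)"] by (simp add: algebra_simps)
        moreover have "k * (k - 1) * (k * card V) \<le> k * (k - 1) * (N * M)"
          using NM by (rule mult_left_mono) simp
        moreover have "3 * (k + 1) * (N * card V)
            \<le> 3 * (k + 1) * ((k - 1) * card V) + k * N * (2 * card V) + k * (k - 1) * (k * card V)"
          by (simp add: s N_def algebra_simps)
        ultimately have "k * N * (3 * (k + 1) * D) \<le> k * N * (2 * card V) + k * (k - 1) * (N * M)"
          by (rule chain)
        also have "\<dots> = k * N * (2 * card V + (k - 1) * M)" by (simp only: distrib_left mult_ac)
        finally have "k * N * (3 * (k + 1) * D) \<le> k * N * (2 * card V + (k - 1) * M)" .
        then have "3 * (k + 1) * D \<le> 2 * card V + (k - 1) * M" using k by (simp add: N_def)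
        then show ?thesis using k by simp
      qed
    qed
  qed
qed

end

section \<open>Tight components as an edge colouring of the complete graph\<close>

lemma tight_rel_in: "(e, e') \<in> tight_rel k E \<Longrightarrow> e \<in> E \<and> e' \<in> E"
  unfolding tight_rel_def tight_walk_def by (auto intro: hd_in_set last_in_set)

lemma equiv_tight_rel: "equiv E (tight_rel k E)"
proof (rule equivI)
  show "tight_rel k E \<subseteq> E \<times> E" using tight_rel_in by fast
  show "refl_on E (tight_rel k E)"
  proof (rule refl_onI)
    fix e assume "e \<in> E"
    then have "tight_walk k E [e]" by (simp add: tight_walk_def)
    then show "(e, e) \<in> tight_rel k E" unfolding tight_rel_def by force
  qed
  show "sym (tight_rel k E)"
  proof (rule symI)
    fix e e' assume "(e, e') \<in> tight_rel k E"
    then obtain es where es: "tight_walk k E es" "hd es = e" "last es = e'"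
      unfolding tight_rel_def by auto
    then have "tight_walk k E (rev es)" by (simp add: tight_walk_def Int_commute)
    moreover have "hd (rev es) = e'" "last (rev es) = e"
      using es by (auto simp: tight_walk_def hd_rev last_rev)
    ultimately show "(e', e) \<in> tight_rel k E" unfolding tight_rel_def by blast
  qed
  show "trans (tight_rel k E)"
  proof (rule transI)
    fix e e' e'' assume "(e, e') \<in> tight_rel k E" "(e', e'') \<in> tight_rel k E"
    then obtain es fs where es: "tight_walk k E es" "hd es = e" "last es = e'"
      and fs: "tight_walk k E fs" "hd fs = e'" "last fs = e''"
      unfolding tight_rel_def by auto
    obtain g gs where gs: "fs = g # gs" using fs by (cases fs) (auto simp: tight_walk_def)
    have "tight_walk k E (es @ gs)"
      using es fs gs by (cases gs) (auto simp: tight_walk_def successively_append_iff)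
    moreover have "hd (es @ gs) = e" "last (es @ gs) = e''"
      using es fs gs by (auto simp: tight_walk_def last_append)
    ultimately show "(e, e'') \<in> tight_rel k E" unfolding tight_rel_def by blast
  qed
qed

lemma tight_rel_of_common_pair:
  assumes "k_graph 3 V E" "e \<in> E" "e' \<in> E" "u \<noteq> v" "{u, v} \<subseteq> e" "{u, v} \<subseteq> e'"
  shows "(e, e') \<in> tight_rel 3 E"
proof (cases "e = e'")
  case True
  then show ?thesis using equiv_class_self[OF equiv_tight_rel assms(2), of 3] by simp
next
  case False
  have e: "card e = 3" "card e' = 3" using assms by (auto simp: k_graph_def)
  then have fin: "finite e" "finite e'" by (auto intro: card_ge_0_finite)
  have "card {u, v} \<le> card (e \<inter> e')" using assms fin by (intro card_mono) auto
  moreover have "card (e \<inter> e') \<noteq> 3"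
    using False e fin card_subset_eq[OF fin(1), of "e \<inter> e'"] card_subset_eq[OF fin(2), of "e \<inter> e'"] by auto
  moreover have "card (e \<inter> e') \<le> 3" using card_mono[OF fin(1), of "e \<inter> e'"] e by auto
  ultimately have "card (e \<inter> e') = 3 - 1" using assms(4) by simp
  then have "tight_walk 3 E [e, e']" using assms by (simp add: tight_walk_def)
  then show ?thesis unfolding tight_rel_def by force
qed

text \<open>Any edge containing the pair gives the same component (\<open>tight_colour_eq\<close>); the value is arbitrary if
  no edge contains it.\<close>

definition tight_colour :: "'a set set \<Rightarrow> 'a \<Rightarrow> 'a \<Rightarrow> 'a set set" where
  "tight_colour E u v = tight_rel 3 E `` {SOME e. e \<in> E \<and> {u, v} \<subseteq> e}"

lemma tight_colour_commute: "tight_colour E u v = tight_colour E v u"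
  by (simp add: tight_colour_def insert_commute)

lemma tight_colour_eq:
  assumes "k_graph 3 V E" "e \<in> E" "u \<noteq> v" "{u, v} \<subseteq> e"
  shows "tight_colour E u v = tight_rel 3 E `` {e}"
proof -
  let ?e = "SOME e. e \<in> E \<and> {u, v} \<subseteq> e"
  have "\<exists>e. e \<in> E \<and> {u, v} \<subseteq> e" using assms by blast
  from someI_ex[OF this] have "?e \<in> E" "{u, v} \<subseteq> ?e" by blast+
  then have "(?e, e) \<in> tight_rel 3 E" using assms by (intro tight_rel_of_common_pair)
  then show ?thesis unfolding tight_colour_def by (rule equiv_class_eq[OF equiv_tight_rel])
qed

lemma min_codegree_le:
  assumes "k_graph 3 V E" "u \<in> V" "v \<in> V" "u \<noteq> v"
  shows "min_codegree 3 V E \<le> card {w \<in> V. w \<noteq> u \<and> w \<noteq> v \<and> {u, v, w} \<in> E}"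
proof -
  have fin: "finite {A. A \<subseteq> V \<and> card A = 3 - 1}" using assms by (simp add: k_graph_def)
  have "min_codegree 3 V E \<le> codegree V E {u, v}"
    unfolding min_codegree_def using assms by (intro Min_le finite_imageI fin imageI) auto
  also have "\<dots> = card {w \<in> V. w \<noteq> u \<and> w \<noteq> v \<and> {u, v, w} \<in> E}"
    unfolding codegree_def by (rule arg_cong[of _ _ card]) (auto simp: insert_commute)
  finally show ?thesis .
qed

lemma tight_colouring:
  assumes G: "k_graph 3 V E" and D: "D \<le> min_codegree 3 V E"
  shows "codegree_colouring V (tight_colour E) D"
proof
  show "finite V" using G by (simp add: k_graph_def)
  show "tight_colour E u v = tight_colour E v u" for u v by (rule tight_colour_commute)
  fix u v assume uv: "u \<in> V" "v \<in> V" "u \<noteq> v"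
  have "D \<le> card {w \<in> V. w \<noteq> u \<and> w \<noteq> v \<and> {u, v, w} \<in> E}"
    using D min_codegree_le[OF G uv] by simp
  also have "\<dots> \<le> card {w \<in> V. w \<noteq> u \<and> w \<noteq> v \<and> tight_colour E u w = tight_colour E u v
      \<and> tight_colour E v w = tight_colour E u v}"
  proof (rule card_mono)
    show "finite {w \<in> V. w \<noteq> u \<and> w \<noteq> v \<and> tight_colour E u w = tight_colour E u v
      \<and> tight_colour E v w = tight_colour E u v}" using G by (simp add: k_graph_def)
    show "{w \<in> V. w \<noteq> u \<and> w \<noteq> v \<and> {u, v, w} \<in> E} \<subseteq>
      {w \<in> V. w \<noteq> u \<and> w \<noteq> v \<and> tight_colour E u w = tight_colour E u v
      \<and> tight_colour E v w = tight_colour E u v}"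
    proof
      fix w assume "w \<in> {w \<in> V. w \<noteq> u \<and> w \<noteq> v \<and> {u, v, w} \<in> E}"
      then have w: "w \<in> V" "w \<noteq> u" "w \<noteq> v" "{u, v, w} \<in> E" by auto
      show "w \<in> {w \<in> V. w \<noteq> u \<and> w \<noteq> v \<and> tight_colour E u w = tight_colour E u v
          \<and> tight_colour E v w = tight_colour E u v}"
        using tight_colour_eq[OF G w(4), of u v] tight_colour_eq[OF G w(4), of u w]
          tight_colour_eq[OF G w(4), of v w] w uv by simp
    qed
  qed
  finally show "D \<le> card {w \<in> V. w \<noteq> u \<and> w \<noteq> v \<and> tight_colour E u w = tight_colour E u v
      \<and> tight_colour E v w = tight_colour E u v}" .
qed

lemma finite_edges: "k_graph k V E \<Longrightarrow> finite E"
  by (rule finite_subset[of _ "Pow V"]) (auto simp: k_graph_def)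

lemma finite_tight_components: "k_graph k V E \<Longrightarrow> finite (tight_components k E)"
  unfolding tight_components_def
  by (rule finite_quotient[OF finite_edges]) (use tight_rel_in in fast)+

lemma spread_tight_colour_le:
  assumes G: "k_graph 3 V E" and D: "1 \<le> min_codegree 3 V E"
  shows "card (codegree_colouring.spread V (tight_colour E) c) \<le> max_tight_cover 3 E"
proof -
  interpret codegree_colouring V "tight_colour E" 1 using G D by (rule tight_colouring)
  have edge: "\<exists>e\<in>E. u \<in> e \<and> c = tight_rel 3 E `` {e}" if "u \<in> spread c" for u
  proof -
    obtain v where v: "u \<in> V" "v \<in> V" "u \<noteq> v" "c = tight_colour E u v"
      using \<open>u \<in> spread c\<close> by (auto simp: spread_def seen_def)
    have "card {w \<in> V. w \<noteq> u \<and> w \<noteq> v \<and> {u, v, w} \<in> E} \<noteq> 0"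
      using min_codegree_le[OF G v(1-3)] D by linarith
    then obtain w where "{u, v, w} \<in> E" by (metis (mono_tags, lifting) card.empty empty_Collect_eq)
    then show ?thesis using tight_colour_eq[OF G, of "{u, v, w}" u v] v by blast
  qed
  show ?thesis
  proof (cases "spread c = {}")
    case False
    then obtain e where e: "e \<in> E" "c = tight_rel 3 E `` {e}" using edge by blast
    then have comp: "c \<in> tight_components 3 E" by (auto simp: tight_components_def intro: quotientI)
    have "spread c \<subseteq> \<Union>c"
    proof
      fix u assume "u \<in> spread c"
      then obtain e' where e': "e' \<in> E" "u \<in> e'" "c = tight_rel 3 E `` {e'}" using edge by blast
      then have "e' \<in> c" using equiv_class_self[OF equiv_tight_rel] by metis
      then show "u \<in> \<Union>c" using e' by blast
    qed
    moreover have "\<Union>c \<subseteq> V" using e tight_rel_in[of _ _ 3 E] G by (fastforce simp: k_graph_def)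
    ultimately have "card (spread c) \<le> card (\<Union>c)"
      using G by (intro card_mono) (auto simp: k_graph_def intro: finite_subset)
    also have "\<dots> \<le> max_tight_cover 3 E"
      unfolding max_tight_cover_def using finite_tight_components[OF G] comp by (intro Max_ge) auto
    finally show ?thesis .
  qed simp
qed

section \<open>Lower bounds\<close>

definition forces_cover :: "nat \<Rightarrow> real \<Rightarrow> real \<Rightarrow> bool" where
  "forces_cover k x c \<longleftrightarrow> (\<forall>C\<ge>0. \<exists>n0. \<forall>n\<ge>n0. \<forall>(V :: nat set) E.
     k_graph k V E \<and> card V = n \<and> real (min_codegree k V E) \<ge> x * real n - C \<longrightarrow>
     real (max_tight_cover k E) \<ge> c * real n)"

lemma tight_f_eq: "tight_f k x = Sup {c \<in> {0..1}. forces_cover k x c}"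
  by (simp add: tight_f_def forces_cover_def)

lemma forces_cover_0: "forces_cover k x 0"
  by (simp add: forces_cover_def)

lemma le_tight_f: "\<lbrakk>0 \<le> c; c \<le> 1; forces_cover k x c\<rbrakk> \<Longrightarrow> c \<le> tight_f k x"
  unfolding tight_f_eq by (intro cSup_upper) (auto intro: bdd_aboveI[of _ 1])

lemma tight_f_le:
  assumes "\<And>c. \<lbrakk>0 \<le> c; c \<le> 1; forces_cover k x c\<rbrakk> \<Longrightarrow> c \<le> b" shows "tight_f k x \<le> b"
  unfolding tight_f_eq
proof (rule cSup_least)
  have "0 \<in> {c \<in> {0..1}. forces_cover k x c}" using forces_cover_0[of k x] by simp
  then show "{c \<in> {0..1}. forces_cover k x c} \<noteq> {}" by blast
qed (use assms in auto)

lemma tight_f_nonneg: "0 \<le> tight_f k x"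
  using forces_cover_0 by (intro le_tight_f) auto

text \<open>A larger codegree is a stronger hypothesis.\<close>

lemma forces_cover_mono:
  assumes "forces_cover k x c" "x \<le> y" shows "forces_cover k y c"
proof -
  have "x * real n - C \<le> y * real n - C" for n C using assms(2) by (simp add: mult_right_mono)
  then show ?thesis using assms(1) unfolding forces_cover_def by (meson order_trans)
qed

lemma tight_f_mono: "x \<le> y \<Longrightarrow> tight_f k x \<le> tight_f k y"
  using forces_cover_mono by (intro tight_f_le le_tight_f)

lemma tight_f_ge_1:
  assumes x: "x > 1/3" shows "tight_f 3 x \<ge> 1"
proof (rule le_tight_f)
  show "forces_cover 3 x 1" unfolding forces_cover_def
  proof (intro allI impI)
    fix C :: real assume "C \<ge> 0"
    obtain n0 :: nat where n0: "C / (x - 1/3) \<le> real n0" using real_arch_simple by blast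
    show "\<exists>n0. \<forall>n\<ge>n0. \<forall>(V :: nat set) E.
     k_graph 3 V E \<and> card V = n \<and> real (min_codegree 3 V E) \<ge> x * real n - C \<longrightarrow>
     real (max_tight_cover 3 E) \<ge> 1 * real n"
    proof (intro exI[of _ "max n0 3"] allI impI)
      fix n and V :: "nat set" and E
      assume n: "max n0 3 \<le> n" and H: "k_graph 3 V E \<and> card V = n \<and> x * real n - C \<le> real (min_codegree 3 V E)"
      have "C / (x - 1/3) \<le> real n" using n0 n by simp
      then have "C \<le> real n * (x - 1/3)" using x by (simp add: pos_divide_le_eq)
      then have "real n / 3 \<le> real (min_codegree 3 V E)" using H by (simp add: algebra_simps)
      then have D: "n \<le> 3 * min_codegree 3 V E" by linarith
      interpret codegree_colouring V "tight_colour E" "min_codegree 3 V E"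
        using H by (intro tight_colouring) auto
      have "1 \<le> min_codegree 3 V E" using D n by linarith
      obtain c where "spread c = V" using spanning_colour D n H by auto
      then have "n \<le> max_tight_cover 3 E"
        using spread_tight_colour_le[of V E c] H \<open>1 \<le> _\<close> by simp
      then show "1 * real n \<le> real (max_tight_cover 3 E)" by simp
    qed
  qed
qed auto

text \<open>Apply \<open>spread_lower_bound\<close> with \<open>D\<close> equal to \<open>x * n\<close> up to an additive constant. For \<open>r = 3\<close> that bound
  has an exception, in which \<open>2/3\<close> of the vertices are covered; this is enough since the claimed value
  does not exceed \<open>2/3\<close> when \<open>x \<le> 8/27\<close>.\<close>

lemma tight_f_ge_linear:
  fixes r :: nat
  assumes r: "r \<ge> 3" and x: "1 / (real r + 1) < x" "x \<le> 1 / real r"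
    and r3: "r = 3 \<Longrightarrow> x \<le> 8/27"
  shows "tight_f 3 x \<ge> (3 * real r * x - 2) / (real r - 2)"
proof -
  define t where "t = (3 * real r * x - 2) / (real r - 2)"
  have xr: "real r * x \<le> 1" using x(2) r by (simp add: field_simps)
  have r2: "real r - 2 \<ge> 1" using r by simp
  have "3 * real r * x - 2 \<le> 1" using xr by (simp only: mult.assoc)
  then have t1: "t \<le> 1" unfolding t_def using r2 by (subst divide_le_eq_1_pos) linarith+
  have c_le: "c \<le> tight_f 3 x" if c: "c < t" "0 \<le> c" for c
  proof (rule le_tight_f)
    show "forces_cover 3 x c" unfolding forces_cover_def
    proof (intro allI impI)
      fix C :: real assume C: "C \<ge> 0"
      have gap: "(real r + 1) * x - 1 > 0" using x(1) by (simp add: field_simps)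
      obtain n1 :: nat where n1: "(real r + 1) * (C + 1) / ((real r + 1) * x - 1) \<le> real n1"
        using real_arch_simple by blast
      obtain n2 :: nat where n2: "3 * real r * (C + 1) / ((real r - 2) * (t - c)) \<le> real n2"
        using real_arch_simple by blast
      show "\<exists>n0. \<forall>n\<ge>n0. \<forall>(V :: nat set) E.
        k_graph 3 V E \<and> card V = n \<and> real (min_codegree 3 V E) \<ge> x * real n - C \<longrightarrow>
        real (max_tight_cover 3 E) \<ge> c * real n"
      proof (intro exI[of _ "max 2 (max n1 n2)"] allI impI)
        fix n and V :: "nat set" and E
        assume n: "max 2 (max n1 n2) \<le> n"
          and H: "k_graph 3 V E \<and> card V = n \<and> x * real n - C \<le> real (min_codegree 3 V E)"
        have "(real r + 1) * (C + 1) / ((real r + 1) * x - 1) \<le> real n" using n1 n by simp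
        then have big1: "(real r + 1) * (C + 1) \<le> real n * ((real r + 1) * x - 1)"
          using gap by (simp add: pos_divide_le_eq)
        have "3 * real r * (C + 1) / ((real r - 2) * (t - c)) \<le> real n" using n2 n by simp
        moreover have "(real r - 2) * (t - c) > 0" using c r2 by simp
        ultimately have big2: "3 * real r * (C + 1) \<le> real n * ((real r - 2) * (t - c))"
          by (simp add: pos_divide_le_eq)
        \<comment> \<open>Subtracting \<open>C + 1\<close> instead of \<open>C\<close> leaves room for rounding up, so that \<open>r * D \<le> n\<close> holds even
          for \<open>x = 1 / r\<close>.\<close>
        define D where "D = nat \<lceil>x * real n - (C + 1)\<rceil>"
        have "real n \<le> (real r + 1) * (x * real n - (C + 1))"
          using big1 by (simp add: algebra_simps)
        then have pos: "0 < x * real n - (C + 1)"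
        proof (rule contrapos_pp)
          assume "\<not> 0 < x * real n - (C + 1)"
          then have "(real r + 1) * (x * real n - (C + 1)) \<le> 0" by (intro mult_nonneg_nonpos) auto
          then show "\<not> real n \<le> (real r + 1) * (x * real n - (C + 1))" using n by linarith
        qed
        then have D: "x * real n - (C + 1) \<le> real D" "real D < x * real n - C"
          unfolding D_def by linarith+
        have Dmin: "D \<le> min_codegree 3 V E" using D(2) H by linarith
        have "D \<ge> 1" using D(1) pos by linarith
        have "real r * real D \<le> real r * (x * real n)" using D(2) C by (intro mult_left_mono) auto
        also have "\<dots> = (real r * x) * real n" by simp
        also have "\<dots> \<le> 1 * real n" using xr by (rule mult_right_mono) simp
        finally have "real (r * D) \<le> real n" by simp
        then have rD: "r * D \<le> n" by (simp only: of_nat_le_iff)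
        have "(real r + 1) * (x * real n - (C + 1)) \<le> (real r + 1) * real D"
          using D(1) by (intro mult_left_mono) auto
        with \<open>real n \<le> (real r + 1) * (x * real n - (C + 1))\<close>
        have "real n \<le> (real r + 1) * real D" by linarith
        then have "real n \<le> real ((r + 1) * D)" by (simp only: of_nat_mult of_nat_add of_nat_1)
        then have nD: "n \<le> (r + 1) * D" by (simp only: of_nat_le_iff)
        interpret codegree_colouring V "tight_colour E" D
          using H Dmin by (intro tight_colouring) auto
        have M: "card (spread c) \<le> max_tight_cover 3 E" for c
          using spread_tight_colour_le[of V E c] H Dmin \<open>D \<ge> 1\<close> by auto
        define M where "M = real (max_tight_cover 3 E)"
        from spread_lower_bound[OF r _ _ _ M] n rD nD H
        consider "3 * r * D \<le> 2 * n + (r - 2) * max_tight_cover 3 E"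
          | "r = 3" "2 * n \<le> 3 * max_tight_cover 3 E" by auto
        then show "c * real n \<le> real (max_tight_cover 3 E)"
        proof cases
          case 1
          then have "real (3 * r * D) \<le> real (2 * n + (r - 2) * max_tight_cover 3 E)"
            by (simp only: of_nat_le_iff)
          then have a: "3 * real r * real D \<le> 2 * real n + (real r - 2) * M"
            using r by (simp add: M_def of_nat_diff)
          have "3 * real r * (x * real n - (C + 1)) \<le> 3 * real r * real D"
            using D(1) by (intro mult_left_mono) auto
          moreover have "(real r - 2) * t = 3 * real r * x - 2" using r2 by (simp add: t_def)
          then have "(real r - 2) * t * real n = 3 * real r * x * real n - 2 * real n"
            by (simp only: left_diff_distrib)
          ultimately have "(real r - 2) * (c * real n) \<le> (real r - 2) * M"
            using a big2 by (simp add: algebra_simps)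
          then show ?thesis using r2 by (simp add: M_def)
        next
          case 2
          have "t \<le> 2/3" using r3[OF 2(1)] 2(1) by (simp add: t_def)
          then have "c * real n \<le> 2/3 * real n" using c by (intro mult_right_mono) auto
          also have "\<dots> \<le> real (max_tight_cover 3 E)" using 2(2) by linarith
          finally show ?thesis .
        qed
      qed
    qed
  qed (use c t1 in auto)
  have "t \<le> tight_f 3 x"
  proof (rule dense_le)
    fix c assume "c < t"
    then show "c \<le> tight_f 3 x"
      using c_le[of c] tight_f_nonneg[of 3 x] by (cases "0 \<le> c") auto
  qed
  then show ?thesis by (simp add: t_def)
qed

section \<open>Hypergraphs of monochromatic triangles\<close>

context codegree_colouring begin

definition mono_edge :: "'c \<Rightarrow> 'v set \<Rightarrow> bool" where
  "mono_edge c e \<longleftrightarrow> e \<subseteq> V \<and> card e = 3 \<and> (\<forall>u\<in>e. \<forall>v\<in>e. u \<noteq> v \<longrightarrow> col u v = c)"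

definition mono_edges :: "'v set set" where
  "mono_edges = {e. \<exists>c. mono_edge c e}"

lemma mono_edgeD: "\<lbrakk>mono_edge c e; u \<in> e; v \<in> e; u \<noteq> v\<rbrakk> \<Longrightarrow> col u v = c"
  unfolding mono_edge_def by blast

lemma k_graph_mono_edges: "k_graph 3 V mono_edges"
  using finV by (auto simp: k_graph_def mono_edges_def mono_edge_def)

lemma min_codegree_mono_edges:
  assumes "card V \<ge> 2" shows "D \<le> min_codegree 3 V mono_edges"
proof -
  have fin: "finite {A. A \<subseteq> V \<and> card A = 3 - 1}" using finV by simp
  obtain A where "A \<subseteq> V" "card A = 2" using obtain_subset_with_card_n[OF assms] by blast
  then have ne: "{A. A \<subseteq> V \<and> card A = 3 - 1} \<noteq> {}" by auto
  have "D \<le> codegree V mono_edges A" if A: "A \<subseteq> V" "card A = 2" for A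
  proof -
    obtain u v where uv: "A = {u, v}" "u \<noteq> v" using A(2) by (meson card_2_iff)
    have "D \<le> card {w \<in> V. w \<noteq> u \<and> w \<noteq> v \<and> col u w = col u v \<and> col v w = col u v}"
      using A uv by (intro mono_codegree) auto
    also have "\<dots> \<le> codegree V mono_edges A" unfolding codegree_def
    proof (rule card_mono)
      show "{w \<in> V. w \<noteq> u \<and> w \<noteq> v \<and> col u w = col u v \<and> col v w = col u v}
          \<subseteq> {w \<in> V - A. insert w A \<in> mono_edges}"
      proof
        fix w assume "w \<in> {w \<in> V. w \<noteq> u \<and> w \<noteq> v \<and> col u w = col u v \<and> col v w = col u v}"
        then have w: "w \<in> V" "w \<noteq> u" "w \<noteq> v" "col u w = col u v" "col v w = col u v" by auto
        have "mono_edge (col u v) (insert w A)"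
          using w uv A col_sym[of w u] col_sym[of w v] col_sym[of v u]
          by (auto simp: mono_edge_def)
        then show "w \<in> {w \<in> V - A. insert w A \<in> mono_edges}"
          using w uv by (auto simp: mono_edges_def)
      qed
    qed (use finV in auto)
    finally show ?thesis .
  qed
  then show ?thesis unfolding min_codegree_def using fin ne by (subst Min_ge_iff) auto
qed

text \<open>Consecutive edges of a tight walk share a pair of vertices, and with it their colour.\<close>

lemma mono_edge_tight_rel:
  assumes "(e, e') \<in> tight_rel 3 mono_edges" "mono_edge c e" shows "mono_edge c e'"
proof -
  have step: "mono_edge c f'" if ff: "mono_edge c f" "f' \<in> mono_edges" "card (f \<inter> f') = 2" for f f'
  proof -
    obtain c' where c': "mono_edge c' f'" using ff by (auto simp: mono_edges_def)
    obtain u v where "f \<inter> f' = {u, v}" "u \<noteq> v" using ff(3) by (meson card_2_iff)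
    then have "u \<in> f" "v \<in> f" "u \<in> f'" "v \<in> f'" by blast+
    then have "c = c'" using mono_edgeD[OF ff(1) _ _ \<open>u \<noteq> v\<close>] mono_edgeD[OF c' _ _ \<open>u \<noteq> v\<close>] by simp
    then show ?thesis using c' by simp
  qed
  have "mono_edge c (last es)" if "tight_walk 3 mono_edges es" "mono_edge c (hd es)" for es
    using that
  proof (induction es)
    case (Cons f fs)
    show ?case
    proof (cases fs)
      case fs: (Cons g gs)
      then have "tight_walk 3 mono_edges fs" "mono_edge c g"
        using Cons.prems step[of f g] by (auto simp: tight_walk_def)
      then show ?thesis using Cons.IH fs by simp
    qed (use Cons.prems in simp)
  qed (simp add: tight_walk_def)
  then show ?thesis using assms unfolding tight_rel_def by auto
qed

lemma max_tight_cover_mono_edges: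
  assumes B: "\<And>c. card (spread c) \<le> B"
  shows "max_tight_cover 3 mono_edges \<le> B"
proof -
  have "card (\<Union>T) \<le> B" if "T \<in> tight_components 3 mono_edges" for T
  proof -
    obtain e where e: "e \<in> mono_edges" "T = tight_rel 3 mono_edges `` {e}"
      using \<open>T \<in> _\<close> by (auto simp: tight_components_def elim: quotientE)
    then obtain c where c: "mono_edge c e" by (auto simp: mono_edges_def)
    have "\<Union>T \<subseteq> spread c"
    proof
      fix u assume "u \<in> \<Union>T"
      then obtain f where f: "(e, f) \<in> tight_rel 3 mono_edges" "u \<in> f" using e by blast
      then have mf: "mono_edge c f" using mono_edge_tight_rel c by blast
      then have "\<not> f \<subseteq> {u}" using card_mono[of "{u}" f] by (auto simp: mono_edge_def)
      then obtain v where "v \<in> f" "v \<noteq> u" by blast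
      moreover have "f \<subseteq> V" using mf by (simp add: mono_edge_def)
      ultimately show "u \<in> spread c"
        using col_in_seen[of v u] mono_edgeD[OF mf f(2), of v] f(2) by (auto simp: spread_def)
    qed
    then have "card (\<Union>T) \<le> card (spread c)" by (intro card_mono) auto
    then show ?thesis using B[of c] by linarith
  qed
  then show ?thesis
    unfolding max_tight_cover_def using finite_tight_components[OF k_graph_mono_edges] by simp
qed

end

section \<open>Projective planes over finite fields\<close>

text \<open>Every projective plane of order \<open>k - 1\<close> is such a linear space with lines of size \<open>k\<close>. These axioms
  suffice for the blow-up below, and they are easier to check than those of \<open>projective_plane\<close>.\<close>

definition linear_space :: "nat \<Rightarrow> 'p set \<Rightarrow> 'p set set \<Rightarrow> bool" where
  "linear_space k P L \<longleftrightarrow> finite P \<and> (\<forall>l\<in>L. l \<subseteq> P \<and> card l = k) \<and>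
     (\<forall>a\<in>P. \<forall>b\<in>P. a \<noteq> b \<longrightarrow> (\<exists>!l. l \<in> L \<and> a \<in> l \<and> b \<in> l))"

datatype 'a plane_point = Affine 'a 'a | Slope 'a | Vertical

definition plane_points :: "'a set \<Rightarrow> 'a plane_point set" where
  "plane_points K = (\<lambda>(x, y). Affine x y) ` (K \<times> K) \<union> Slope ` K \<union> {Vertical}"

definition slanted_line :: "'a::comm_ring_1 set \<Rightarrow> 'a \<Rightarrow> 'a \<Rightarrow> 'a plane_point set" where
  "slanted_line K m b = insert (Slope m) ((\<lambda>x. Affine x (m * x + b)) ` K)"

definition vertical_line :: "'a set \<Rightarrow> 'a \<Rightarrow> 'a plane_point set" where
  "vertical_line K a = insert Vertical (Affine a ` K)"

definition line_at_infinity :: "'a set \<Rightarrow> 'a plane_point set" where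
  "line_at_infinity K = insert Vertical (Slope ` K)"

definition plane_lines :: "'a::comm_ring_1 set \<Rightarrow> 'a plane_point set set" where
  "plane_lines K = (\<lambda>(m, b). slanted_line K m b) ` (K \<times> K) \<union> vertical_line K ` K \<union> {line_at_infinity K}"

lemma card_plane_points:
  assumes "finite K" shows "card (plane_points K) = card K * (card K + 1) + 1"
proof -
  let ?A = "(\<lambda>(x, y). Affine x y) ` (K \<times> K)"
  have "inj_on (\<lambda>(x, y). Affine x y) (K \<times> K)" "inj_on Slope K" by (auto simp: inj_on_def)
  then have a: "card ?A = card K * card K" and b: "card (Slope ` K) = card K"
    by (simp_all add: card_image card_cartesian_product)
  have fin: "finite ?A" "finite (Slope ` K)" using assms by auto
  have "card (?A \<union> Slope ` K) = card ?A + card (Slope ` K)"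
    by (rule card_Un_disjoint[OF fin]) auto
  moreover have "card (insert Vertical (?A \<union> Slope ` K)) = Suc (card (?A \<union> Slope ` K))"
    by (rule card_insert_disjoint) (use fin in auto)
  moreover have "plane_points K = insert Vertical (?A \<union> Slope ` K)"
    by (auto simp: plane_points_def)
  ultimately show ?thesis using a b by simp
qed

lemma Affine_slanted: "Affine x y \<in> slanted_line K m b \<longleftrightarrow> x \<in> K \<and> y = m * x + b"
  and Slope_slanted: "Slope s \<in> slanted_line K m b \<longleftrightarrow> s = m"
  and Vertical_slanted: "Vertical \<notin> slanted_line K m b"
  and Affine_vertical: "Affine x y \<in> vertical_line K a \<longleftrightarrow> x = a \<and> y \<in> K"
  and Slope_vertical: "Slope s \<notin> vertical_line K a"
  and Vertical_vertical: "Vertical \<in> vertical_line K a"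
  and Affine_infinity: "Affine x y \<notin> line_at_infinity K"
  and Slope_infinity: "Slope s \<in> line_at_infinity K \<longleftrightarrow> s \<in> K"
  and Vertical_infinity: "Vertical \<in> line_at_infinity K"
  by (auto simp: slanted_line_def vertical_line_def line_at_infinity_def)

text \<open>A formula for the line through two distinct points, used to show that it is unique.\<close>

fun line_through :: "'a::field set \<Rightarrow> 'a plane_point \<Rightarrow> 'a plane_point \<Rightarrow> 'a plane_point set" where
  "line_through K (Affine x y) (Affine x' y') =
     (if x = x' then vertical_line K x
      else let m = (y - y') / (x - x') in slanted_line K m (y - m * x))"
| "line_through K (Affine x y) (Slope m) = slanted_line K m (y - m * x)"
| "line_through K (Slope m) (Affine x y) = slanted_line K m (y - m * x)"
| "line_through K (Affine x y) Vertical = vertical_line K x"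
| "line_through K Vertical (Affine x y) = vertical_line K x"
| "line_through K (Slope m) b = line_at_infinity K"
| "line_through K Vertical b = line_at_infinity K"

text \<open>The affine plane over \<open>K\<close> with a line at infinity. The trivial ring \<open>K = {0}\<close> satisfies the
  hypotheses and yields the triangle, the plane of order one.\<close>

lemma linear_space_over_subfield:
  fixes K :: "'a::field set"
  assumes fin: "finite K" and diff: "\<And>x y. x \<in> K \<Longrightarrow> y \<in> K \<Longrightarrow> x - y \<in> K"
    and mult: "\<And>x y. x \<in> K \<Longrightarrow> y \<in> K \<Longrightarrow> x * y \<in> K"
    and inv: "\<And>x. x \<in> K \<Longrightarrow> inverse x \<in> K" and ne: "K \<noteq> {}"
  shows "linear_space (card K + 1) (plane_points K) (plane_lines K)"
proof -
  have zero: "0 \<in> K" using ne diff by fastforce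
  have minus: "- x \<in> K" if "x \<in> K" for x using diff[OF zero that] by simp
  have add: "x + y \<in> K" if "x \<in> K" "y \<in> K" for x y using diff[OF that(1) minus[OF that(2)]] by simp
  have divide: "x / y \<in> K" if "x \<in> K" "y \<in> K" for x y
    using mult[OF that(1) inv[OF that(2)]] by (simp add: field_simps)
  have slanted: "slanted_line K m b \<subseteq> plane_points K \<and> card (slanted_line K m b) = card K + 1"
    if "m \<in> K" "b \<in> K" for m b
    using that fin mult add unfolding slanted_line_def plane_points_def
    by (subst card_insert_disjoint) (auto simp: card_image inj_on_def)
  have vertical: "vertical_line K a \<subseteq> plane_points K \<and> card (vertical_line K a) = card K + 1"
    if "a \<in> K" for a
    using that fin unfolding vertical_line_def plane_points_def
    by (subst card_insert_disjoint) (auto simp: card_image inj_on_def)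
  have infinity: "line_at_infinity K \<subseteq> plane_points K \<and> card (line_at_infinity K) = card K + 1"
    using fin unfolding line_at_infinity_def plane_points_def
    by (subst card_insert_disjoint) (auto simp: card_image inj_on_def)
  have ex: "\<exists>l\<in>plane_lines K. a \<in> l \<and> b \<in> l" if "a \<in> plane_points K" "b \<in> plane_points K" for a b
  proof -
    have slantI: "?thesis" if "m \<in> K" "c \<in> K" "a \<in> slanted_line K m c" "b \<in> slanted_line K m c" for m c
      using that unfolding plane_lines_def by blast
    have vertI: "?thesis" if "c \<in> K" "a \<in> vertical_line K c" "b \<in> vertical_line K c" for c
      using that unfolding plane_lines_def by blast
    have infI: "?thesis" if "a \<in> line_at_infinity K" "b \<in> line_at_infinity K"
      using that unfolding plane_lines_def by blast
    show ?thesis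
    proof (cases a)
      case a: (Affine x y)
      then have xy: "x \<in> K" "y \<in> K" using that by (auto simp: plane_points_def)
      show ?thesis
      proof (cases b)
        case b: (Affine x' y')
        then have xy': "x' \<in> K" "y' \<in> K" using that by (auto simp: plane_points_def)
        show ?thesis
        proof (cases "x = x'")
          case True
          then show ?thesis using a b xy xy' by (intro vertI[of x]) (auto simp: vertical_line_def)
        next
          case False
          define m where "m = (y - y') / (x - x')"
          have m: "m \<in> K" unfolding m_def using xy xy' by (intro divide diff)
          have "m * (x - x') = y - y'" using False by (simp add: m_def)
          then have eq: "y' = m * x' + (y - m * x)" by (simp add: algebra_simps)
          have c: "y - m * x \<in> K" using xy m diff mult by blast
          have "a \<in> slanted_line K m (y - m * x)" "b \<in> slanted_line K m (y - m * x)"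
            using a b xy xy' eq unfolding slanted_line_def by auto
          then show ?thesis using m c by (intro slantI)
        qed
      next
        case b: (Slope m)
        then have m: "m \<in> K" using that by (auto simp: plane_points_def)
        have c: "y - m * x \<in> K" using xy m diff mult by blast
        have "a \<in> slanted_line K m (y - m * x)" "b \<in> slanted_line K m (y - m * x)"
          using a b xy unfolding slanted_line_def by auto
        then show ?thesis using m c by (intro slantI)
      next
        case Vertical
        then show ?thesis using a xy by (intro vertI[of x]) (auto simp: vertical_line_def)
      qed
    next
      case a: (Slope m)
      then have m: "m \<in> K" using that by (auto simp: plane_points_def)
      show ?thesis
      proof (cases b)
        case b: (Affine x y)
        then have xy: "x \<in> K" "y \<in> K" using that by (auto simp: plane_points_def)
        have c: "y - m * x \<in> K" using xy m diff mult by blast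
        have "a \<in> slanted_line K m (y - m * x)" "b \<in> slanted_line K m (y - m * x)"
          using a b xy unfolding slanted_line_def by auto
        then show ?thesis using m c by (intro slantI)
      qed (rule infI; use a m that in \<open>auto simp: line_at_infinity_def plane_points_def\<close>)+
    next
      case a: Vertical
      show ?thesis
      proof (cases b)
        case (Affine x y)
        then show ?thesis using a that
          by (intro vertI[of x]) (auto simp: vertical_line_def plane_points_def)
      qed (rule infI; use a that in \<open>auto simp: line_at_infinity_def plane_points_def\<close>)+
    qed
  qed
  note mem = Affine_slanted Slope_slanted Vertical_slanted Affine_vertical Slope_vertical
    Vertical_vertical Affine_infinity Slope_infinity Vertical_infinity
  have uniq: "l = l'" if ll: "l \<in> plane_lines K" "l' \<in> plane_lines K" "a \<noteq> b"
    "a \<in> l" "a \<in> l'" "b \<in> l" "b \<in> l'" for l l' a b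
  proof -
    have "l = line_through K a b" if "l \<in> plane_lines K" "a \<in> l" "b \<in> l" for l
    proof -
      consider m c where "l = slanted_line K m c" | c where "l = vertical_line K c"
        | "l = line_at_infinity K"
        using \<open>l \<in> plane_lines K\<close> by (auto simp: plane_lines_def)
      then show ?thesis
      proof cases
        case 1
        then show ?thesis using that ll(3) by (cases a; cases b) (auto simp: mem Let_def simp flip: right_diff_distrib)
      next
        case 2
        then show ?thesis using that ll(3) by (cases a; cases b) (auto simp: mem)
      next
        case 3
        then show ?thesis using that ll(3) by (cases a; cases b) (auto simp: mem)
      qed
    qed
    from this[OF ll(1,4,6)] this[OF ll(2,5,7)] show ?thesis by simp
  qed
  show ?thesis unfolding linear_space_def
  proof (intro conjI ballI impI)
    show "finite (plane_points K)" using fin by (simp add: plane_points_def)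
  next
    fix l assume "l \<in> plane_lines K"
    then consider m c where "m \<in> K" "c \<in> K" "l = slanted_line K m c"
      | c where "c \<in> K" "l = vertical_line K c" | "l = line_at_infinity K"
      by (auto simp: plane_lines_def)
    then have "l \<subseteq> plane_points K \<and> card l = card K + 1"
      by cases (simp_all only: slanted vertical infinity)
    then show "l \<subseteq> plane_points K" "card l = card K + 1" by simp_all
  next
    fix a b assume ab: "a \<in> plane_points K" "b \<in> plane_points K" "a \<noteq> b"
    show "\<exists>!l. l \<in> plane_lines K \<and> a \<in> l \<and> b \<in> l"
    proof (rule ex_ex1I)
      show "\<exists>l. l \<in> plane_lines K \<and> a \<in> l \<and> b \<in> l" using ex[OF ab(1,2)] by blast
    next
      fix l l' assume "l \<in> plane_lines K \<and> a \<in> l \<and> b \<in> l" "l' \<in> plane_lines K \<and> a \<in> l' \<and> b \<in> l'"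
      then show "l = l'" using uniq[of l l' a b] ab(3) by simp
    qed
  qed
qed

lemma linear_space_image:
  assumes "linear_space k P L" and inj: "inj_on f P"
  shows "linear_space k (f ` P) ((`) f ` L)"
proof -
  have LP: "l \<subseteq> P" "card l = k" if "l \<in> L" for l using assms that by (auto simp: linear_space_def)
  have mem: "f a \<in> f ` l \<longleftrightarrow> a \<in> l" if "a \<in> P" "l \<in> L" for a l
    using inj_on_image_mem_iff[OF inj that(1) LP(1)[OF that(2)]] .
  show ?thesis unfolding linear_space_def
  proof (intro conjI ballI impI)
    show "finite (f ` P)" using assms by (simp add: linear_space_def)
  next
    fix l assume "l \<in> (`) f ` L"
    then show "l \<subseteq> f ` P" "card l = k"
      using LP card_image[OF inj_on_subset[OF inj]] by auto
  next
    fix x y assume "x \<in> f ` P" "y \<in> f ` P" "x \<noteq> y"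
    then obtain a b where ab: "a \<in> P" "b \<in> P" "a \<noteq> b" "x = f a" "y = f b" by blast
    then have ex1: "\<exists>!l. l \<in> L \<and> a \<in> l \<and> b \<in> l" using assms by (simp add: linear_space_def)
    show "\<exists>!l. l \<in> (`) f ` L \<and> x \<in> l \<and> y \<in> l"
    proof (rule ex_ex1I)
      show "\<exists>l. l \<in> (`) f ` L \<and> x \<in> l \<and> y \<in> l" using ex1 ab by blast
    next
      fix l l' assume l: "l \<in> (`) f ` L \<and> x \<in> l \<and> y \<in> l"
        and l': "l' \<in> (`) f ` L \<and> x \<in> l' \<and> y \<in> l'"
      obtain m m' where m: "m \<in> L" "l = f ` m" and m': "m' \<in> L" "l' = f ` m'"
        using l l' by (meson imageE)
      have "a \<in> m" "b \<in> m" using l mem[OF ab(1) m(1)] mem[OF ab(2) m(1)] by (simp_all add: m ab)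
      moreover have "a \<in> m'" "b \<in> m'"
        using l' mem[OF ab(1) m'(1)] mem[OF ab(2) m'(1)] by (simp_all add: m' ab)
      ultimately show "l = l'" using ex1 m m' by blast
    qed
  qed
qed

definition plane_order :: "nat \<Rightarrow> bool" where
  "plane_order q \<longleftrightarrow> (\<exists>L :: nat set set. linear_space (q + 1) {..<q * (q + 1) + 1} L)"

lemma plane_orderI:
  fixes K :: "'a::field set"
  assumes fin: "finite K" "K \<noteq> {}" and "\<And>x y. x \<in> K \<Longrightarrow> y \<in> K \<Longrightarrow> x - y \<in> K"
    and "\<And>x y. x \<in> K \<Longrightarrow> y \<in> K \<Longrightarrow> x * y \<in> K"
    and "\<And>x. x \<in> K \<Longrightarrow> inverse x \<in> K"
  shows "plane_order (card K)"
proof -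
  have "finite (plane_points K)" using fin by (simp add: plane_points_def)
  then obtain f where "bij_betw f (plane_points K) {0..<card (plane_points K)}"
    using ex_bij_betw_finite_nat by blast
  then have f: "inj_on f (plane_points K)" "f ` plane_points K = {..<card K * (card K + 1) + 1}"
    unfolding card_plane_points[OF fin(1)] by (simp_all add: bij_betw_def lessThan_atLeast0)
  show ?thesis
    using linear_space_image[OF linear_space_over_subfield[OF fin(1) assms(3-5) fin(2)] f(1)]
    unfolding plane_order_def f(2) by blast
qed

lemma plane_order_1: "plane_order 1"
  using plane_orderI[of "{0 :: rat}"] by simp

text \<open>The derivative of \<open>X ^ q - X\<close> is \<open>- 1\<close>, so there are no multiple roots.\<close>

lemma card_roots_power_minus_self:
  fixes q :: nat
  assumes "of_nat q = (0 :: 'a)" and "q \<ge> 2"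
  shows "card {x :: 'a :: alg_closed_field. x ^ q = x} = q"
proof -
  define f :: "'a poly" where "f = monom 1 q - [:0, 1:]"
  have deg: "degree f = q" unfolding f_def
    using assms(2) degree_add_eq_left[of "- [:0, 1:]" "monom (1::'a) q"]
    by (simp only: diff_conv_add_uminus) (simp add: degree_monom_eq)
  have f0: "f \<noteq> 0" using deg assms(2) by auto
  have "pderiv f = - 1"
    by (simp add: f_def pderiv_diff pderiv_monom assms(1) pderiv_pCons one_pCons)
  then have "poly (pderiv f) a \<noteq> 0" for a by simp
  then have simple: "order a f \<le> 1" for a
  proof -
    have False if "[:-a, 1:] ^ 2 dvd f"
    proof -
      from that obtain g where "f = [:-a, 1:] * ([:-a, 1:] * g)"
        by (metis dvd_def mult.assoc power2_eq_square)
      then have "poly (pderiv f) a = 0" by (simp only: pderiv_mult poly_add poly_mult) simp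
      then show False using \<open>\<And>a. poly (pderiv f) a \<noteq> 0\<close> by blast
    qed
    then show ?thesis using order_divides[of a 2 f] f0 by fastforce
  qed
  obtain A where A: "size A = degree f" "f = smult (lead_coeff f) (\<Prod>x\<in>#A. [:-x, 1:])"
    using alg_closed_imp_factorization[OF f0] by blast
  have pr: "proots f = A"
  proof -
    have "proots f = proots (\<Prod>x\<in>#A. [:-x, 1:])"
      using A(2) f0 by (metis leading_coeff_0_iff proots_smult)
    also have "\<dots> = A"
    proof (induction A)
      case (add x A)
      have "(\<Prod>x\<in>#A. [:-x, 1:]) \<noteq> 0"
        by (induction A) (auto simp del: mult_pCons_left)
      then show ?case using add by (simp add: proots_mult del: mult_pCons_left)
    qed simp
    finally show ?thesis .
  qed
  have "size A = (\<Sum>x\<in>set_mset A. count A x)" by (simp add: size_multiset_overloaded_eq)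
  also have "\<dots> = (\<Sum>x\<in>set_mset A. 1)"
  proof (rule sum.cong[OF refl])
    fix x assume "x \<in># A"
    then have "poly f x = 0" using pr f0 set_count_proots by blast
    then have "order x f = 1" using simple[of x] f0 order_root[of f x] by force
    then show "count A x = 1" using pr f0 count_proots by metis
  qed
  also have "\<dots> = card {x. poly f x = 0}" using pr f0 set_count_proots by fastforce
  also have "{x. poly f x = 0} = {x. x ^ q = x}" by (auto simp: f_def poly_monom)
  finally show ?thesis using A(1) deg by simp
qed

text \<open>The roots are the fixed points of a power of the Frobenius endomorphism.\<close>

lemma subfield_of_card_power:
  assumes "prime CHAR('a)" and "n > 0"
  defines "K \<equiv> {x :: 'a :: alg_closed_field. x ^ (CHAR('a) ^ n) = x}"
  shows "card K = CHAR('a) ^ n" "\<And>x y. x \<in> K \<Longrightarrow> y \<in> K \<Longrightarrow> x - y \<in> K"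
    "\<And>x y. x \<in> K \<Longrightarrow> y \<in> K \<Longrightarrow> x * y \<in> K" "\<And>x. x \<in> K \<Longrightarrow> inverse x \<in> K"
proof -
  have "CHAR('a) ^ n \<ge> CHAR('a)" using assms by (intro self_le_power) (auto simp: prime_gt_0_nat Suc_leI)
  then have q2: "CHAR('a) ^ n \<ge> 2" using prime_ge_2_nat[OF assms(1)] by linarith
  have "of_nat (CHAR('a) ^ n) = (0 :: 'a)" using assms(2) by (simp add: zero_power)
  then show "card K = CHAR('a) ^ n" unfolding K_def using q2 by (rule card_roots_power_minus_self)
  show "x - y \<in> K" if "x \<in> K" "y \<in> K" for x y
  proof -
    have "((x - y) + y) ^ (CHAR('a) ^ n) = (x - y) ^ (CHAR('a) ^ n) + y ^ (CHAR('a) ^ n)"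
      by (rule freshmans_dream'[OF assms(1) refl])
    then have "x = (x - y) ^ (CHAR('a) ^ n) + y" using that by (simp add: K_def)
    then show ?thesis by (simp add: K_def eq_diff_eq)
  qed
qed (auto simp: K_def power_mult_distrib power_inverse)

text \<open>A field of prime order is a type whose size is the prime, so the prime cannot be a free variable of
  a theorem about such types. Instead, take a constant prime that violates the claim if any prime
  does, and a type of that size: the claim for this single prime implies it for all.\<close>

definition plane_failing_prime :: nat where
  "plane_failing_prime = (if \<exists>p. prime p \<and> (\<exists>n>0. \<not> plane_order (p ^ n))
     then SOME p. prime p \<and> (\<exists>n>0. \<not> plane_order (p ^ n)) else 2)"

lemma plane_failing_prime_fails:
  assumes "\<exists>p. prime p \<and> (\<exists>n>0. \<not> plane_order (p ^ n))"
  shows "prime plane_failing_prime \<and> (\<exists>n>0. \<not> plane_order (plane_failing_prime ^ n))"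
  using someI_ex[OF assms] unfolding plane_failing_prime_def if_P[OF assms] .

lemma prime_plane_failing_prime: "prime plane_failing_prime"
proof (cases "\<exists>p. prime p \<and> (\<exists>n>0. \<not> plane_order (p ^ n))")
  case True
  then show ?thesis by (rule plane_failing_prime_fails[THEN conjunct1])
next
  case False
  show ?thesis unfolding plane_failing_prime_def if_not_P[OF False] by (rule two_is_prime_nat)
qed

typedef plane_failing_index = "{..<plane_failing_prime}"
  using prime_gt_0_nat[OF prime_plane_failing_prime] by blast

lemma card_plane_failing_index: "CARD(plane_failing_index) = plane_failing_prime"
  using type_definition.card[OF type_definition_plane_failing_index] by simp

instance plane_failing_index :: prime_card
  by standard (simp add: card_plane_failing_index prime_plane_failing_prime)

lemma plane_order_plane_failing_prime:
  assumes "n > 0" shows "plane_order (plane_failing_prime ^ n)"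
proof -
  have ch: "CHAR(plane_failing_index mod_ring alg_closure) = plane_failing_prime"
    by (simp only: CHAR_alg_closure semiring_char_mod_ring card_plane_failing_index)
  define K where "K = {x :: plane_failing_index mod_ring alg_closure. x ^ (CHAR(plane_failing_index mod_ring alg_closure) ^ n) = x}"
  have "prime CHAR(plane_failing_index mod_ring alg_closure)" using ch prime_plane_failing_prime by simp
  from subfield_of_card_power[OF this assms, folded K_def]
  have K: "card K = plane_failing_prime ^ n" "\<And>x y. x \<in> K \<Longrightarrow> y \<in> K \<Longrightarrow> x - y \<in> K"
    "\<And>x y. x \<in> K \<Longrightarrow> y \<in> K \<Longrightarrow> x * y \<in> K" "\<And>x. x \<in> K \<Longrightarrow> inverse x \<in> K"
    unfolding ch by blast+
  have "card K \<noteq> 0" using K(1) prime_plane_failing_prime by simp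
  then have "finite K" "K \<noteq> {}" by (auto intro: card_ge_0_finite)
  from plane_orderI[OF this K(2-4)] show ?thesis unfolding K(1) .
qed

theorem plane_order_prime_power:
  assumes "primepow q" shows "plane_order q"
proof (rule ccontr)
  assume "\<not> plane_order q"
  moreover obtain p n where pn: "prime p" "n > 0" "q = p ^ n" using assms by (auto simp: primepow_def)
  ultimately have ex: "\<exists>p. prime p \<and> (\<exists>n>0. \<not> plane_order (p ^ n))" by blast
  from plane_failing_prime_fails[OF this] show False using plane_order_plane_failing_prime by blast
qed

section \<open>Blown-up projective planes and upper bounds\<close>

lemma card_residue_class:
  fixes p N m :: nat
  assumes "p < N"
  shows "card {w \<in> {..<N * m}. w mod N = p \<and> P (w div N)} = card {b \<in> {..<m}. P b}"
proof -
  have "bij_betw (\<lambda>b. p + N * b) {b \<in> {..<m}. P b} {w \<in> {..<N * m}. w mod N = p \<and> P (w div N)}"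
  proof (rule bij_betw_byWitness[where f' = "\<lambda>w. w div N"])
    show "(\<lambda>b. p + N * b) ` {b \<in> {..<m}. P b} \<subseteq> {w \<in> {..<N * m}. w mod N = p \<and> P (w div N)}"
    proof clarsimp
      fix b assume "b < m" "P b"
      have "p + N * b < N * Suc b" using assms by simp
      also have "\<dots> \<le> N * m" using \<open>b < m\<close> by (intro mult_left_mono) auto
      finally show "p + N * b < N * m \<and> p mod N = p \<and> P ((p + N * b) div N)"
        using assms \<open>P b\<close> by simp
    qed
    show "(\<lambda>w. w div N) ` {w \<in> {..<N * m}. w mod N = p \<and> P (w div N)} \<subseteq> {b \<in> {..<m}. P b}"
      by (auto simp: less_mult_imp_div_less mult.commute)
  qed (use assms in auto)
  then show ?thesis by (rule bij_betw_same_card[symmetric])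
qed

lemma card_residue_classes:
  fixes N m :: nat
  assumes "A \<subseteq> {..<N}"
  shows "card {w \<in> {..<N * m}. w mod N \<in> A} = card A * m"
proof -
  have finA: "finite A" using assms by (rule finite_subset) simp
  have "{w \<in> {..<N * m}. w mod N \<in> A} = (\<Union>p\<in>A. {w \<in> {..<N * m}. w mod N = p \<and> True})" by auto
  then have "card {w \<in> {..<N * m}. w mod N \<in> A}
      = (\<Sum>p\<in>A. card {w \<in> {..<N * m}. w mod N = p \<and> True})"
    by (simp only:) (rule card_UN_disjoint, use finA in auto)
  also have "\<dots> = (\<Sum>p\<in>A. m)"
    using assms card_residue_class[of _ N m "\<lambda>_. True"] by (intro sum.cong refl) auto
  finally show ?thesis by simp
qed

text \<open>Addition of \<open>a\<close> permutes the residues.\<close>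

lemma card_shifted_residue:
  assumes "t < s"
  shows "card {b \<in> {..<s * m}. (a + b) mod s = t} = (m :: nat)"
proof -
  define b0 where "b0 = (t + s - a mod s) mod s"
  have b0: "b0 < s" using assms by (simp add: b0_def)
  have am: "a mod s < s" using assms by simp
  have "(a + b0) mod s = (a mod s + (t + s - a mod s)) mod s"
    unfolding b0_def by (simp add: mod_simps)
  also have "a mod s + (t + s - a mod s) = t + s" using am by simp
  finally have eq: "(a + b0) mod s = t" using assms by simp
  have "(a + b) mod s = t \<longleftrightarrow> b mod s = b0" for b
  proof -
    have "(a + b) mod s = t \<longleftrightarrow> (a + b) mod s = (a + b0) mod s" using eq by simp
    also have "\<dots> \<longleftrightarrow> b mod s = b0 mod s" 
      using cong_add_lcancel_nat[of a b b0 s] by (simp only: cong_def)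
    finally show ?thesis using b0 by simp
  qed
  then have "{b \<in> {..<s * m}. (a + b) mod s = t} = {b \<in> {..<s * m}. b mod s = b0 \<and> True}" by simp
  then show ?thesis using card_residue_class[OF b0, of m "\<lambda>_. True"] by simp
qed

text \<open>The lines through \<open>p\<close> partition the other \<open>q * (q + 1)\<close> points into sets of size \<open>q\<close>.\<close>

lemma linear_space_pencil:
  assumes L: "linear_space (q + 1) {..<q * (q + 1) + 1} L" and q: "q \<ge> 1" and p: "p < q * (q + 1) + 1"
  shows "card {l \<in> L. p \<in> l} = q + 1"
proof -
  let ?P = "{..<q * (q + 1) + 1}" and ?S = "{l \<in> L. p \<in> l}"
  have L1: "l \<subseteq> ?P" "card l = q + 1" if "l \<in> L" for l using L that by (auto simp: linear_space_def)
  have uniq: "\<exists>!l. l \<in> L \<and> p \<in> l \<and> b \<in> l" if "b \<in> ?P" "b \<noteq> p" for b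
    using L p that by (auto simp: linear_space_def)
  have finL: "finite L" by (rule finite_subset[of _ "Pow ?P"]) (use L1 in auto)
  have "?P - {p} = (\<Union>l\<in>?S. l - {p})"
  proof
    show "?P - {p} \<subseteq> (\<Union>l\<in>?S. l - {p})" using uniq by blast
    show "(\<Union>l\<in>?S. l - {p}) \<subseteq> ?P - {p}" using L1 by blast
  qed
  then have "card (?P - {p}) = card (\<Union>l\<in>?S. l - {p})" by simp
  also have "\<dots> = (\<Sum>l\<in>?S. card (l - {p}))"
  proof (rule card_UN_disjoint)
    show "\<forall>l\<in>?S. finite (l - {p})" using L1 finite_subset[of _ ?P] by blast
    show "\<forall>l\<in>?S. \<forall>l'\<in>?S. l \<noteq> l' \<longrightarrow> (l - {p}) \<inter> (l' - {p}) = {}"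
      using uniq L1 by blast
  qed (use finL in auto)
  also have "\<dots> = (\<Sum>l\<in>?S. q)"
    using L1(2) by (intro sum.cong refl) simp
  finally have "q * (q + 1) = q * card ?S" using p by simp
  then show ?thesis using q by (simp only: mult_cancel1) simp
qed

text \<open>Vertex \<open>u\<close> is in the class of the point \<open>u mod N\<close>, where it has the index \<open>u div N\<close>. Within a class, the
  sum of the indices modulo \<open>q + 1\<close> selects one of the \<open>q + 1\<close> lines through the point, so a vertex has
  equally many neighbours for each line, up to one. A pair in different classes, coloured \<open>l\<close>, forms
  monochromatic triangles with the \<open>q - 1\<close> other classes on \<open>l\<close> and with the \<open>l\<close>-neighbours of each of
  the two vertices inside its own class; a pair inside a class does so with all \<open>q\<close> other classes
  on its line.\<close>

lemma blow_up_colouring: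
  assumes L: "linear_space (q + 1) {..<q * (q + 1) + 1} L" and q: "q \<ge> 1"
  defines "N \<equiv> q * (q + 1) + 1"
  shows "\<exists>col :: nat \<Rightarrow> nat \<Rightarrow> nat set.
    codegree_colouring {..<N * ((q + 1) * m)} col (((q - 1) * (q + 1) + 2) * m - 2) \<and>
    (\<forall>c. card (codegree_colouring.spread {..<N * ((q + 1) * m)} col c) \<le> (q + 1) * ((q + 1) * m))"
proof -
  let ?V = "{..<N * ((q + 1) * m)}"
  have L1: "l \<subseteq> {..<N}" "card l = q + 1" if "l \<in> L" for l
    using L that by (auto simp: linear_space_def N_def)
  have uniq: "\<exists>!l. l \<in> L \<and> a \<in> l \<and> b \<in> l" if "a < N" "b < N" "a \<noteq> b" for a b
    using L that by (auto simp: linear_space_def N_def)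
  define line where "line a b = (THE l. l \<in> L \<and> a \<in> l \<and> b \<in> l)" for a b
  have line: "line a b \<in> L" "a \<in> line a b" "b \<in> line a b" if "a < N" "b < N" "a \<noteq> b" for a b
    using theI'[OF uniq[OF that]] by (auto simp: line_def)
  have line_eq: "line a b = l" if "a \<noteq> b" "l \<in> L" "a \<in> l" "b \<in> l" for a b l
    unfolding line_def using uniq[of a b] L1(1)[OF that(2)] that by (intro the1_equality) auto
  have line_commute: "line a b = line b a" for a b by (simp add: line_def conj_commute)
  have "\<exists>f. bij_betw f {..<q + 1} {l \<in> L. p \<in> l}" if "p < N" for p
  proof -
    have "card {l \<in> L. p \<in> l} = q + 1" using linear_space_pencil[OF L q] that by (simp add: N_def)
    then show ?thesis using ex_bij_betw_nat_finite[of "{l \<in> L. p \<in> l}"]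
      by (metis card.infinite lessThan_atLeast0 add_is_0 one_neq_zero)
  qed
  then obtain pencil where pencil: "\<And>p. p < N \<Longrightarrow> bij_betw (pencil p) {..<q + 1} {l \<in> L. p \<in> l}"
    by metis
  define col where "col u v = (if u mod N = v mod N
      then pencil (u mod N) ((u div N + v div N) mod (q + 1)) else line (u mod N) (v mod N))" for u v
  have N0: "N > 0" by (simp add: N_def)
  then have modN: "u mod N < N" for u by simp
  have col_line: "col u v \<in> L" "u mod N \<in> col u v" for u v
  proof -
    have "pencil (u mod N) ((u div N + v div N) mod (q + 1)) \<in> {l \<in> L. u mod N \<in> l}"
      using pencil[OF modN] by (rule bij_betw_apply) simp
    then show "col u v \<in> L" "u mod N \<in> col u v" using line[OF modN modN] by (auto simp: col_def)
  qed
  have col_commute: "col u v = col v u" for u v by (simp add: col_def line_commute add.commute)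
  let ?D = "((q - 1) * (q + 1) + 2) * m - 2"
  have colouring: "codegree_colouring ?V col ?D"
  proof
    show "finite ?V" by simp
    show "col u v = col v u" for u v by (rule col_commute)
    fix u v assume uv: "u \<in> ?V" "v \<in> ?V" "u \<noteq> v"
    define l where "l = col u v"
    have l: "l \<in> L" "u mod N \<in> l" "v mod N \<in> l"
      using col_line[of u v] col_line[of v u] col_commute[of u v] by (auto simp: l_def)
    let ?W = "{w \<in> ?V. w \<noteq> u \<and> w \<noteq> v \<and> col u w = col u v \<and> col v w = col u v}"
    let ?O = "{w \<in> ?V. w mod N \<in> l - {u mod N, v mod N}}"
    have outer: "?O \<subseteq> ?W"
    proof
      fix w assume w: "w \<in> ?O"
      then have "col u w = l" "col v w = l" using line_eq[OF _ l(1)] l by (auto simp: col_def)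
      then show "w \<in> ?W" using w by (auto simp: l_def)
    qed
    have cO: "card ?O = card (l - {u mod N, v mod N}) * ((q + 1) * m)"
      using L1(1)[OF l(1)] by (intro card_residue_classes) auto
    have finl: "finite l" using L1(1)[OF l(1)] finite_subset by blast
    show "?D \<le> card ?W"
    proof (cases "u mod N = v mod N")
      case True
      then have "card (l - {u mod N, v mod N}) = q" using l L1(2)[OF l(1)] finl by simp
      then have "q * ((q + 1) * m) \<le> card ?W" using cO card_mono[OF _ outer] by simp
      moreover have "((q - 1) * (q + 1) + 2) \<le> q * (q + 1)"
        using q by (cases q) (auto simp: algebra_simps)
      then have "((q - 1) * (q + 1) + 2) * m \<le> q * (q + 1) * m" by (rule mult_right_mono) simp
      then have "((q - 1) * (q + 1) + 2) * m \<le> q * ((q + 1) * m)" by (simp only: mult.assoc)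
      ultimately show ?thesis by linarith
    next
      case False
      \<comment> \<open>The vertex \<open>a\<close> itself may be among the \<open>m\<close> vertices of its class with the right index sum.\<close>
      have inner: "m - 1 \<le> card {w \<in> ?V. w mod N = a mod N \<and> w \<noteq> a \<and> col a w = l}"
        if a: "a \<in> ?V" "a mod N \<in> l" for a
      proof -
        have "l \<in> pencil (a mod N) ` {..<q + 1}"
          using bij_betw_imp_surj_on[OF pencil[OF modN[of a]]] l(1) a(2) by simp
        then obtain t where t: "t < q + 1" "pencil (a mod N) t = l" by blast
        let ?X = "{w \<in> ?V. w mod N = a mod N \<and> (a div N + w div N) mod (q + 1) = t}"
        have "card ?X = card {b \<in> {..<(q + 1) * m}. (a div N + b) mod (q + 1) = t}"
          by (rule card_residue_class[OF modN])
        also have "\<dots> = m" by (rule card_shifted_residue[OF t(1)])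
        finally have "m - 1 \<le> card (?X - {a})"
          using diff_card_le_card_Diff[of "{a}" ?X] by simp
        also have "\<dots> \<le> card {w \<in> ?V. w mod N = a mod N \<and> w \<noteq> a \<and> col a w = l}"
        proof (rule card_mono)
          show "?X - {a} \<subseteq> {w \<in> ?V. w mod N = a mod N \<and> w \<noteq> a \<and> col a w = l}"
          proof
            fix w assume w: "w \<in> ?X - {a}"
            then have "col a w = l" unfolding col_def using t(2) by simp
            then show "w \<in> {w \<in> ?V. w mod N = a mod N \<and> w \<noteq> a \<and> col a w = l}" using w by simp
          qed
        qed simp
        finally show ?thesis .
      qed
      let ?X = "\<lambda>a. {w \<in> ?V. w mod N = a mod N \<and> w \<noteq> a \<and> col a w = l}"
      have Xu: "?X u \<subseteq> ?W"
      proof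
        fix w assume w: "w \<in> ?X u"
        then have "col v w = l" using False line_eq[OF _ l(1,3,2)] by (auto simp: col_def)
        then show "w \<in> ?W" using w False by (auto simp: l_def)
      qed
      have Xv: "?X v \<subseteq> ?W"
      proof
        fix w assume w: "w \<in> ?X v"
        then have "col u w = l" using False line_eq[OF _ l] by (auto simp: col_def)
        then show "w \<in> ?W" using w False by (auto simp: l_def)
      qed
      have "card (l - {u mod N, v mod N}) = q - 1"
        using l L1(2)[OF l(1)] finl False by (simp add: card_Diff_subset)
      then have "card ?O = (q - 1) * ((q + 1) * m)" using cO by simp
      moreover have "card (?O \<union> ?X u \<union> ?X v) = card ?O + card (?X u) + card (?X v)"
      proof -
        have "?O \<inter> ?X u = {}" by blast
        then have "card (?O \<union> ?X u) = card ?O + card (?X u)" by (intro card_Un_disjoint) auto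
        moreover have "(?O \<union> ?X u) \<inter> ?X v = {}" using False by fastforce
        then have "card (?O \<union> ?X u \<union> ?X v) = card (?O \<union> ?X u) + card (?X v)"
          by (intro card_Un_disjoint) auto
        ultimately show ?thesis by simp
      qed
      moreover have "card (?O \<union> ?X u \<union> ?X v) \<le> card ?W"
        using outer Xu Xv by (intro card_mono Un_least) simp_all
      ultimately have "(q - 1) * ((q + 1) * m) + (m - 1) + (m - 1) \<le> card ?W"
        using inner[OF uv(1) l(2)] inner[OF uv(2) l(3)] by linarith
      moreover have "((q - 1) * (q + 1) + 2) * m = (q - 1) * ((q + 1) * m) + 2 * m"
        by (simp only: distrib_right mult.assoc)
      ultimately show ?thesis by linarith
    qed
  qed
  interpret codegree_colouring ?V col ?D by (rule colouring)
  have "card (spread c) \<le> (q + 1) * ((q + 1) * m)" for c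
  proof (cases "c \<in> L")
    case True
    have "spread c \<subseteq> {w \<in> ?V. w mod N \<in> c}"
      unfolding spread_def seen_def using col_line(2) by blast
    then have "card (spread c) \<le> card {w \<in> ?V. w mod N \<in> c}" by (intro card_mono) auto
    also have "\<dots> = (q + 1) * ((q + 1) * m)"
      using card_residue_classes[OF L1(1)[OF True]] L1(2)[OF True] by simp
    finally show ?thesis .
  next
    case False
    then have "spread c = {}" unfolding spread_def seen_def using col_line(1) by blast
    then show ?thesis by simp
  qed
  then show ?thesis using colouring by blast
qed

text \<open>The blow-ups have codegree at least \<open>x * n - 2\<close> for infinitely many \<open>n\<close>.\<close>

lemma tight_f_le_of_plane:
  assumes "plane_order q" and q: "q \<ge> 1"
    and x: "x \<le> (real q - 1 + 2 / (real q + 1)) / (real q * (real q + 1) + 1)"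
  shows "tight_f 3 x \<le> (real q + 1) / (real q * (real q + 1) + 1)"
proof (rule tight_f_le)
  fix c assume c: "forces_cover 3 x c"
  obtain L :: "nat set set" where L: "linear_space (q + 1) {..<q * (q + 1) + 1} L"
    using assms(1) by (auto simp: plane_order_def)
  define N where "N = q * (q + 1) + 1"
  from c obtain n0 where n0: "\<And>n V E. \<lbrakk>n \<ge> n0; k_graph 3 (V :: nat set) E; card V = n;
      real (min_codegree 3 V E) \<ge> x * real n - 2\<rbrakk> \<Longrightarrow> real (max_tight_cover 3 E) \<ge> c * real n"
    unfolding forces_cover_def by (metis zero_le_numeral)
  define m where "m = n0 + 1"
  define n where "n = N * ((q + 1) * m)"
  let ?D = "((q - 1) * (q + 1) + 2) * m - 2"
  obtain col :: "nat \<Rightarrow> nat \<Rightarrow> nat set" where col: "codegree_colouring {..<n} col ?D"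
    and B: "\<And>c. card (codegree_colouring.spread {..<n} col c) \<le> (q + 1) * ((q + 1) * m)"
    using blow_up_colouring[OF L q, of m] unfolding n_def N_def by blast
  interpret codegree_colouring "{..<n}" col ?D by (rule col)
  have "m \<le> (q + 1) * m" by simp
  also have "\<dots> \<le> n" by (simp add: n_def N_def)
  finally have nm: "m \<le> n" .
  have "2 * m \<le> (q + 1) * m" using q by (intro mult_right_mono) auto
  also have "\<dots> \<le> n" by (simp add: n_def N_def)
  finally have n2: "2 \<le> n" by (simp add: m_def)
  have q1: "real (q - 1) = real q - 1" using q by simp
  have m2: "2 \<le> ((q - 1) * (q + 1) + 2) * m" by (simp add: m_def)
  have "N > 0" by (simp add: N_def)
  then have pos: "real q + 1 > 0" "real N > 0" by simp_all
  have N: "real N = real q * (real q + 1) + 1" by (simp add: N_def algebra_simps)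
  have "x * real n \<le> (real q - 1 + 2 / (real q + 1)) / real N * real n"
    using x unfolding N by (rule mult_right_mono) simp
  also have "\<dots> = ((real q - 1) * (real q + 1) + 2) * real m"
  proof -
    have "(real q - 1 + 2 / (real q + 1)) / real N * (real N * ((real q + 1) * real m))
        = (real q - 1 + 2 / (real q + 1)) * (real q + 1) * real m"
      using pos by simp
    also have "\<dots> = ((real q - 1) * (real q + 1) + 2) * real m"
    proof -
      have "(a + 2 / b) * b = a * b + 2" if "b > 0" for a b :: real
        using that by (simp add: distrib_right)
      from this[OF pos(1)] show ?thesis by (simp only:)
    qed
    finally show ?thesis by (simp only: n_def of_nat_mult of_nat_add of_nat_1)
  qed
  also have "\<dots> = real ?D + 2"
  proof -
    have "real ?D = real (((q - 1) * (q + 1) + 2) * m) - 2"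
      using m2 by (simp only: of_nat_diff of_nat_numeral)
    also have "real (((q - 1) * (q + 1) + 2) * m) = ((real q - 1) * (real q + 1) + 2) * real m"
      by (simp only: of_nat_mult of_nat_add of_nat_1 of_nat_numeral q1)
    finally show ?thesis by simp
  qed
  finally have xD: "x * real n - 2 \<le> real ?D" by simp
  have "c * real n \<le> real (max_tight_cover 3 mono_edges)"
  proof (rule n0[OF _ k_graph_mono_edges])
    show "n0 \<le> n" using nm by (simp add: m_def)
    show "x * real n - 2 \<le> real (min_codegree 3 {..<n} mono_edges)"
      using xD min_codegree_mono_edges n2 by (simp add: order_trans[OF xD])
  qed simp
  also have "\<dots> \<le> real ((q + 1) * ((q + 1) * m))"
    using max_tight_cover_mono_edges[OF B] by (simp only: of_nat_le_iff)
  finally have "c * real N * (real (q + 1) * real m) \<le> real (q + 1) * (real (q + 1) * real m)"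
    by (simp only: n_def of_nat_mult mult.assoc)
  moreover have "real (q + 1) * real m > 0" by (simp add: m_def)
  ultimately have "c * real N \<le> real (q + 1)" by (rule mult_right_le_imp_le)
  then show "c \<le> (real q + 1) / (real q * (real q + 1) + 1)"
    using pos N by (simp add: pos_le_divide_eq add.commute)
qed

section \<open>Bounds for tight components of 3-graphs\<close>

lemma r_seq_cases:
  obtains q where "r_seq i = q + 2" "q = 0 \<or> q = 1 \<or> primepow q"
proof -
  let ?R = "{m + 2 |m :: nat. m = 0 \<or> m = 1 \<or> primepow m}"
  have "(\<lambda>p. p + 2) ` {p :: nat. prime p} \<subseteq> ?R" using primepow_prime by blast
  moreover have "infinite ((\<lambda>p. p + 2) ` {p :: nat. prime p})"
    using primes_infinite by (simp add: finite_image_iff inj_on_def)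
  ultimately have "infinite ?R" by (rule infinite_super)
  then have "r_seq i \<in> ?R" unfolding r_seq_def by (rule enumerate_in_set)
  then show ?thesis using that by blast
qed

lemma tight_f_le_r_seq:
  assumes "x \<le> q_seq i"
  shows "tight_f 3 x \<le> (real (r_seq i) - 1) / ((real (r_seq i))\<^sup>2 - 3 * real (r_seq i) + 3)"
proof -
  obtain q where q: "r_seq i = q + 2" "q = 0 \<or> q = 1 \<or> primepow q" by (rule r_seq_cases)
  have r1: "real (r_seq i) - 1 = real q + 1" using q(1) by simp
  have r2: "(real (r_seq i))\<^sup>2 - 3 * real (r_seq i) + 3 = real q * (real q + 1) + 1"
    using q(1) by (simp add: power2_eq_square algebra_simps)
  show ?thesis
  proof (cases "q = 0")
    case True
    have "tight_f 3 x \<le> 1" by (rule tight_f_le)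
    then show ?thesis unfolding r1 r2 using True by simp
  next
    case False
    then have "plane_order q" using q(2) plane_order_1 plane_order_prime_power by auto
    moreover have "x \<le> (real q - 1 + 2 / (real q + 1)) / (real q * (real q + 1) + 1)"
    proof -
      have "real (r_seq i) - 3 = real q - 1" using q(1) by simp
      then show ?thesis using assms unfolding q_seq_def Let_def r1 r2 by (simp only:)
    qed
    ultimately show ?thesis unfolding r1 r2 using False by (intro tight_f_le_of_plane) auto
  qed
qed

theorem theorem2:
  shows "(\<forall>i. \<forall>x\<in>{q_seq (Suc i)<..q_seq i}.
      tight_f 3 x \<le> (real (r_seq i) - 1) / ((real (r_seq i))\<^sup>2 - 3 * real (r_seq i) + 3)) \<and>
    (\<forall>x\<in>{0..1::real}.
      (x > 1/3 \<longrightarrow> tight_f 3 x \<ge> 1) \<and>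
      (8/27 \<le> x \<and> x \<le> 1/3 \<longrightarrow> tight_f 3 x \<ge> 2/3) \<and>
      (5/18 \<le> x \<and> x \<le> 8/27 \<longrightarrow> tight_f 3 x \<ge> 9 * x - 2) \<and>
      (\<forall>r::nat. r \<ge> 3 \<and> 1 / (real r + 1) \<le> x \<and>
          x \<le> ((3 * real r - 4) / (3 * real r - 3)) * (1 / real r) \<longrightarrow>
        tight_f 3 x \<ge> 1 / (real r - 1)) \<and>
      (\<forall>r::nat. r \<ge> 4 \<and> ((3 * real r - 4) / (3 * real r - 3)) * (1 / real r) \<le> x \<and>
          x \<le> 1 / real r \<longrightarrow>
        tight_f 3 x \<ge> (3 * real r * x - 2) / (real r - 2)))"
proof (intro conjI allI ballI impI)
  fix i x assume "x \<in> {q_seq (Suc i)<..q_seq i}"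
  then show "tight_f 3 x \<le> (real (r_seq i) - 1) / ((real (r_seq i))\<^sup>2 - 3 * real (r_seq i) + 3)"
    by (intro tight_f_le_r_seq) simp
next
  fix x :: real assume "x > 1/3"
  then show "tight_f 3 x \<ge> 1" by (rule tight_f_ge_1)
next
  fix x :: real assume x: "8/27 \<le> x \<and> x \<le> 1/3"
  have "2/3 \<le> tight_f 3 (8/27)" using tight_f_ge_linear[of 3 "8/27"] by simp
  also have "\<dots> \<le> tight_f 3 x" using x by (intro tight_f_mono) simp
  finally show "tight_f 3 x \<ge> 2/3" .
next
  fix x :: real assume x: "5/18 \<le> x \<and> x \<le> 8/27"
  then have "(3 * real 3 * x - 2) / (real 3 - 2) \<le> tight_f 3 x"
    by (intro tight_f_ge_linear) auto
  then show "tight_f 3 x \<ge> 9 * x - 2" by simp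
next
  fix x :: real and r :: nat
  assume "r \<ge> 3 \<and> 1 / (real r + 1) \<le> x \<and> x \<le> ((3 * real r - 4) / (3 * real r - 3)) * (1 / real r)"
  then have r: "r \<ge> 3" and x: "1 / (real r + 1) \<le> x" by auto
  \<comment> \<open>At its left end, this range meets the right end of the sloping range for \<open>r + 1\<close>.\<close>
  have "(3 * real (r + 1) * (1 / (real r + 1)) - 2) / (real (r + 1) - 2) \<le> tight_f 3 (1 / (real r + 1))"
    using r by (intro tight_f_ge_linear) (auto simp: field_simps)
  moreover have "3 * real (r + 1) * (1 / (real r + 1)) = 3" by (simp add: divide_eq_eq)
  ultimately have "1 / (real r - 1) \<le> tight_f 3 (1 / (real r + 1))" by simp
  also have "\<dots> \<le> tight_f 3 x" using x by (rule tight_f_mono)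
  finally show "tight_f 3 x \<ge> 1 / (real r - 1)" .
next
  fix x :: real and r :: nat
  assume "r \<ge> 4 \<and> ((3 * real r - 4) / (3 * real r - 3)) * (1 / real r) \<le> x \<and> x \<le> 1 / real r"
  then have r: "r \<ge> 4" and x: "((3 * real r - 4) / (3 * real r - 3)) * (1 / real r) \<le> x" "x \<le> 1 / real r"
    by auto
  have "1 / (real r + 1) < ((3 * real r - 4) / (3 * real r - 3)) * (1 / real r)"
  proof -
    have "(3 * real r - 3) * real r < (3 * real r - 4) * (real r + 1)"
      using r by (simp add: algebra_simps)
    moreover have "(3 * real r - 3) * real r > 0" using r by simp
    ultimately show ?thesis using r by (simp add: divide_less_eq less_divide_eq mult.commute)
  qed
  then show "tight_f 3 x \<ge> (3 * real r * x - 2) / (real r - 2)"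
    using r x by (intro tight_f_ge_linear) auto
qed

end
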